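(* Let $q>p$. There is a constant $C>0$, depending only on $p$, $q$, $d$ and $\Omega$, such that if the minimizer $u$ of $\mathcal J$ satisfies $\nabla u\in L^{q,\infty}(\Omega)$, then for every $\varepsilon=[\varepsilon_-,\varepsilon_+]$ with $0<\varepsilon_-\le\varepsilon_+<\infty$ $$\mathcal J_\varepsilon(u_\varepsilon)-\mathcal J(u)\le C\Big(\varepsilon_-^p+\varepsilon_+^{-(q-p)}\,\|\nabla u\|_{L^{q,\infty}(\Omega)}^q\Big).$$
   Context: Standing setting: $\Omega\subset\mathbb R^d$ is open and bounded, $1<p<2$, $f\in (W_0^{1,p}(\Omega))^*$. The energy is $\mathcal J(v):=\frac1p\int_\Omega|\nabla v|^p\,dx-\langle f,v\rangle$ on $W_0^{1,p}(\Omega)$ and $u$ is its unique minimizer. For $\varepsilon=[\varepsilon_-,\varepsilon_+]$ with $0<\varepsilon_-\le\varepsilon_+<\infty$ define $$\kappa_\varepsilon(t):=\begin{cases}\frac12\varepsilon_-^{p-2}t^2+(\frac1p-\frac12)\varepsilon_-^p & t\le\varepsilon_-,\\ \frac1p t^p & \varepsilon_-\le t\le\varepsilon_+,\\ \frac12\varepsilon_+^{p-2}t^2+(\frac1p-\frac12)\varepsilon_+^p & t\ge\varepsilon_+,\end{cases}$$ and $\mathcal J_\varepsilon(v):=\int_\Omega\kappa_\varepsilon(|\nabla v|)\,dx-\langle f,v\rangle$, as a functional $W_0^{1,p}(\Omega)\to\mathbb R\cup\{\infty\}$ (finite exactly on $W_0^{1,2}(\Omega)$); $u_\varepsilon$ is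 its unique minimizer. $L^{q,\infty}(\Omega)$ is the weak-$L^q$ space with $\|v\|_{L^{q,\infty}(\Omega)}:=\sup_{t>0}\|t\,\chi_{\{|v|>t\}}\|_{L^q(\Omega)}<\infty$. Lipschitz truncation (a result from earlier literature which the paper takes as available on $\Omega$): for $v\in W_0^{1,p}(\Omega)$ and $\lambda>0$ let $\mathcal O_\lambda(v):=\{x\in\Omega: M(\nabla v)(x)>\lambda\}$, where $(Mg)(x):=\sup_{r>0}\frac1{|B_r(x)|}\int_{B_r(x)}|g|\,dy$ and $\nabla v$ is extended by zero outside $\Omega$. There is $T_\lambda v\in W_0^{1,\infty}(\Omega)$ such that, with constants depending only on $p,d,\Omega$: $\{v\ne T_\lambda v\}\subset\mathcal O_\lambda(v)$; $\|T_\lambda v\|_{L^p}\lesssim\|v\|_{L^p}$; $\|\nabla T_\lambda v\|_{L^p}\lesssim\|\nabla v\|_{L^p}$; $|\nabla T_\lambda v|\lesssim\lambda\chi_{\mathcal O_\lambda(v)}+|\nabla v|\chi_{\Omega\setminus\mathcal O_\lambda(v)}$, so that $|\nabla T_\lambda v|\le c_1\lambda$ a.e.; $\|\nabla(v-T_\lambda v)\|_{L^p(\Omega)}\lesssim\|\nabla v\|_{L^p(\mathcal O_\lambda(v))}$; $T_\lambda v\to v$ in $W_0^{1,p}(\Omega)$ as $\lambda\to\infty$. *)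

theory Defs
  imports "HOL-Analysis.Analysis"
begin

text \<open>
  Functions on an open set \<open>\<Omega>\<close> are total functions whose values outside \<open>\<Omega>\<close> are irrelevant;
  elements of Lebesgue and Sobolev spaces are represented by such functions rather than by
  equivalence classes modulo null sets.
\<close>

subsection \<open>Lebesgue and weak Lebesgue spaces\<close>

definition Lp_space :: "real \<Rightarrow> 'a::euclidean_space set \<Rightarrow> ('a \<Rightarrow> 'b::real_normed_vector) set" where
  "Lp_space r \<Omega> = {g. g \<in> borel_measurable (lebesgue_on \<Omega>) \<and>
     integrable (lebesgue_on \<Omega>) (\<lambda>x. norm (g x) powr r)}"

definition Lp_norm :: "real \<Rightarrow> 'a::euclidean_space set \<Rightarrow> ('a \<Rightarrow> 'b::real_normed_vector) \<Rightarrow> real" where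
  "Lp_norm r \<Omega> g = (LINT x|lebesgue_on \<Omega>. norm (g x) powr r) powr (1 / r)"

definition Linf_space :: "'a::euclidean_space set \<Rightarrow> ('a \<Rightarrow> 'b::real_normed_vector) set" where
  "Linf_space \<Omega> = {g. g \<in> borel_measurable (lebesgue_on \<Omega>) \<and>
     (\<exists>K. AE x in lebesgue_on \<Omega>. norm (g x) \<le> K)}"

definition weak_Lp_norm :: "real \<Rightarrow> 'a::euclidean_space set \<Rightarrow> ('a \<Rightarrow> 'b::real_normed_vector) \<Rightarrow> ennreal" where
  "weak_Lp_norm q \<Omega> g =
     (SUP t\<in>{0<..}. ennreal (Lp_norm q \<Omega> (\<lambda>x. t * indicat_real {y. norm (g y) > t} x)))"

definition weak_Lp_space :: "real \<Rightarrow> 'a::euclidean_space set \<Rightarrow> ('a \<Rightarrow> 'b::real_normed_vector) set" where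
  "weak_Lp_space q \<Omega> = {g. g \<in> borel_measurable (lebesgue_on \<Omega>) \<and> weak_Lp_norm q \<Omega> g < \<infinity>}"

subsection \<open>Test functions and weak gradients\<close>

fun Ck :: "nat \<Rightarrow> ('a::real_normed_vector \<Rightarrow> 'b::real_normed_vector) \<Rightarrow> bool" where
  "Ck 0 f \<longleftrightarrow> continuous_on UNIV f"
| "Ck (Suc k) f \<longleftrightarrow> (\<forall>x. f differentiable (at x)) \<and>
     (\<forall>h. Ck k (\<lambda>x. frechet_derivative f (at x) h))"

definition test_functions :: "'a::euclidean_space set \<Rightarrow> ('a \<Rightarrow> real) set" where
  "test_functions \<Omega> = {\<phi>. (\<forall>k. Ck k \<phi>) \<and>
     compact (closure {x. \<phi> x \<noteq> 0}) \<and> closure {x. \<phi> x \<noteq> 0} \<subseteq> \<Omega>}"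

definition locally_integrable :: "'a::euclidean_space set \<Rightarrow> ('a \<Rightarrow> 'b::euclidean_space) \<Rightarrow> bool" where
  "locally_integrable \<Omega> g \<longleftrightarrow> (\<forall>K. compact K \<and> K \<subseteq> \<Omega> \<longrightarrow> integrable (lebesgue_on K) g)"

definition has_weak_gradient :: "'a::euclidean_space set \<Rightarrow> ('a \<Rightarrow> real) \<Rightarrow> ('a \<Rightarrow> 'a) \<Rightarrow> bool" where
  "has_weak_gradient \<Omega> v G \<longleftrightarrow> locally_integrable \<Omega> v \<and> locally_integrable \<Omega> G \<and>
     (\<forall>\<phi>\<in>test_functions \<Omega>. \<forall>i\<in>Basis.
        (LINT x|lebesgue_on \<Omega>. v x * frechet_derivative \<phi> (at x) i) =
        - (LINT x|lebesgue_on \<Omega>. (G x \<bullet> i) * \<phi> x))"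

text \<open>Weak gradients are unique up to null sets; one representative is chosen.\<close>

definition wgrad :: "'a::euclidean_space set \<Rightarrow> ('a \<Rightarrow> real) \<Rightarrow> 'a \<Rightarrow> 'a" where
  "wgrad \<Omega> v = (SOME G. has_weak_gradient \<Omega> v G)"

subsection \<open>Sobolev spaces\<close>

definition sobolev :: "real \<Rightarrow> 'a::euclidean_space set \<Rightarrow> ('a \<Rightarrow> real) set" where
  "sobolev r \<Omega> = {v \<in> Lp_space r \<Omega>. (\<exists>G. has_weak_gradient \<Omega> v G) \<and> wgrad \<Omega> v \<in> Lp_space r \<Omega>}"

definition sobolev_norm :: "real \<Rightarrow> 'a::euclidean_space set \<Rightarrow> ('a \<Rightarrow> real) \<Rightarrow> real" where
  "sobolev_norm r \<Omega> v = Lp_norm r \<Omega> v + Lp_norm r \<Omega> (wgrad \<Omega> v)"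

text \<open>\<open>W\<^sub>0\<close> with finite exponent \<open>r\<close>: the closure of the test functions in the Sobolev space.\<close>

definition sobolev0 :: "real \<Rightarrow> 'a::euclidean_space set \<Rightarrow> ('a \<Rightarrow> real) set" where
  "sobolev0 r \<Omega> = {v \<in> sobolev r \<Omega>. \<exists>\<phi>::nat \<Rightarrow> 'a \<Rightarrow> real.
     (\<forall>n. \<phi> n \<in> test_functions \<Omega>) \<and> (\<lambda>n. sobolev_norm r \<Omega> (\<lambda>x. v x - \<phi> n x)) \<longlonglongrightarrow> 0}"

text \<open>
  For exponent infinity the norm closure of the test functions would be too small (it contains
  only continuously differentiable functions). As usual, the space consists of the functions with
  bounded weak gradient and zero boundary values, the latter in the sense of every finite exponent;
  for bounded open \<open>\<Omega>\<close> these are the Lipschitz functions vanishing outside \<open>\<Omega>\<close>.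
\<close>

definition sobolev0_inf :: "'a::euclidean_space set \<Rightarrow> ('a \<Rightarrow> real) set" where
  "sobolev0_inf \<Omega> = {v. v \<in> Linf_space \<Omega> \<and> wgrad \<Omega> v \<in> Linf_space \<Omega> \<and> (\<forall>r\<ge>1. v \<in> sobolev0 r \<Omega>)}"

definition sobolev0_dual :: "real \<Rightarrow> 'a::euclidean_space set \<Rightarrow> (('a \<Rightarrow> real) \<Rightarrow> real) set" where
  "sobolev0_dual r \<Omega> = {f.
     (\<forall>v\<in>sobolev0 r \<Omega>. \<forall>w\<in>sobolev0 r \<Omega>. f (\<lambda>x. v x + w x) = f v + f w) \<and>
     (\<forall>a. \<forall>v\<in>sobolev0 r \<Omega>. f (\<lambda>x. a * v x) = a * f v) \<and>
     (\<exists>K. \<forall>v\<in>sobolev0 r \<Omega>. \<bar>f v\<bar> \<le> K * sobolev_norm r \<Omega> v)}"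

subsection \<open>The energies\<close>

definition energy :: "real \<Rightarrow> 'a::euclidean_space set \<Rightarrow> (('a \<Rightarrow> real) \<Rightarrow> real) \<Rightarrow> ('a \<Rightarrow> real) \<Rightarrow> real" where
  "energy p \<Omega> f v = 1 / p * (LINT x|lebesgue_on \<Omega>. norm (wgrad \<Omega> v x) powr p) - f v"

definition kappa :: "real \<Rightarrow> real \<Rightarrow> real \<Rightarrow> real \<Rightarrow> real" where
  "kappa p \<epsilon>m \<epsilon>p t =
     (if t \<le> \<epsilon>m then 1/2 * \<epsilon>m powr (p - 2) * t\<^sup>2 + (1/p - 1/2) * \<epsilon>m powr p
      else if t \<le> \<epsilon>p then 1/p * t powr p
      else 1/2 * \<epsilon>p powr (p - 2) * t\<^sup>2 + (1/p - 1/2) * \<epsilon>p powr p)"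

definition relaxed_energy ::
  "real \<Rightarrow> 'a::euclidean_space set \<Rightarrow> (('a \<Rightarrow> real) \<Rightarrow> real) \<Rightarrow> real \<Rightarrow> real \<Rightarrow> ('a \<Rightarrow> real) \<Rightarrow> ereal" where
  "relaxed_energy p \<Omega> f \<epsilon>m \<epsilon>p v =
     (if v \<in> sobolev0 2 \<Omega>
      then ereal ((LINT x|lebesgue_on \<Omega>. kappa p \<epsilon>m \<epsilon>p (norm (wgrad \<Omega> v x))) - f v)
      else \<infinity>)"

definition is_minimizer ::
  "real \<Rightarrow> 'a::euclidean_space set \<Rightarrow> (('a \<Rightarrow> real) \<Rightarrow> 'c::linorder) \<Rightarrow> ('a \<Rightarrow> real) \<Rightarrow> bool" where
  "is_minimizer p \<Omega> J u \<longleftrightarrow> is_arg_min J (\<lambda>v. v \<in> sobolev0 p \<Omega>) u"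

subsection \<open>Lipschitz truncation\<close>

definition maximal :: "('a::euclidean_space \<Rightarrow> 'b::real_normed_vector) \<Rightarrow> 'a \<Rightarrow> ennreal" where
  "maximal g x = (SUP r\<in>{0<..}.
     (\<integral>\<^sup>+y\<in>ball x r. ennreal (norm (g y)) \<partial>lebesgue) / emeasure lebesgue (ball x r))"

definition bad_set :: "'a::euclidean_space set \<Rightarrow> ('a \<Rightarrow> real) \<Rightarrow> real \<Rightarrow> 'a set" where
  "bad_set \<Omega> v s =
     {x \<in> \<Omega>. maximal (\<lambda>y. indicat_real \<Omega> y *\<^sub>R wgrad \<Omega> v y) x > ennreal s}"

definition is_truncation ::
  "real \<Rightarrow> 'a::euclidean_space set \<Rightarrow> real \<Rightarrow> ('a \<Rightarrow> real) \<Rightarrow> real \<Rightarrow> ('a \<Rightarrow> real) \<Rightarrow> bool" where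
  "is_truncation p \<Omega> c v s w \<longleftrightarrow>
     w \<in> sobolev0_inf \<Omega> \<and>
     (AE x in lebesgue_on \<Omega>. v x \<noteq> w x \<longrightarrow> x \<in> bad_set \<Omega> v s) \<and>
     Lp_norm p \<Omega> w \<le> c * Lp_norm p \<Omega> v \<and>
     Lp_norm p \<Omega> (wgrad \<Omega> w) \<le> c * Lp_norm p \<Omega> (wgrad \<Omega> v) \<and>
     (AE x in lebesgue_on \<Omega>. norm (wgrad \<Omega> w x) \<le>
        c * (s * indicat_real (bad_set \<Omega> v s) x
             + norm (wgrad \<Omega> v x) * indicat_real (\<Omega> - bad_set \<Omega> v s) x)) \<and>
     (AE x in lebesgue_on \<Omega>. norm (wgrad \<Omega> w x) \<le> c * s) \<and>
     Lp_norm p \<Omega> (wgrad \<Omega> (\<lambda>x. v x - w x)) \<le> c * Lp_norm p (bad_set \<Omega> v s) (wgrad \<Omega> v)"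

text \<open>The constant \<open>c\<close> is chosen before \<open>v\<close> and the truncation level \<open>s\<close>, so it depends on \<open>p\<close> and \<open>\<Omega>\<close> only.\<close>

definition admits_lipschitz_truncation :: "real \<Rightarrow> 'a::euclidean_space set \<Rightarrow> bool" where
  "admits_lipschitz_truncation p \<Omega> \<longleftrightarrow>
     (\<exists>c>0. \<forall>v\<in>sobolev0 p \<Omega>. \<exists>T::real \<Rightarrow> 'a \<Rightarrow> real.
        (\<forall>s>0. is_truncation p \<Omega> c v s (T s)) \<and>
        ((\<lambda>s. sobolev_norm p \<Omega> (\<lambda>x. v x - T s x)) \<longlongrightarrow> 0) at_top)"

end

theory Submission
  imports Defs
begin

text \<open>
  The competitor in the relaxed problem is the Lipschitz truncation \<open>w\<close> of \<open>u\<close> at level \<open>s = \<epsilon>p / c\<close>.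
  Its gradient is bounded by \<open>\<epsilon>p\<close>, so the upper cut-off of the energy density is inactive and the lower one
  costs at most \<open>|\<Omega>| \<epsilon>m\<^sup>p / p\<close>. To compare the energies of \<open>w\<close> and \<open>u\<close>, minimality of \<open>u\<close> is tested with
  the reflection \<open>2u - w\<close>; since \<open>p \<le> 2\<close>, the second difference of \<open>|\<cdot>|\<^sup>p\<close> at \<open>\<nabla>u\<close> with increment
  \<open>\<nabla>(u - w)\<close> is at most \<open>2 |\<nabla>(u - w)|\<^sup>p\<close>. The integral of the latter is controlled by that of \<open>|\<nabla>u|\<^sup>p\<close>
  over the bad set, which splits into the tail of \<open>|\<nabla>u|\<^sup>p\<close> above \<open>s\<close> (dyadic summation of the weak
  \<open>L\<^sup>q\<close> bound) and \<open>s\<^sup>p\<close> times the measure of the bad set (weak type (1,1) estimate).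
  The weak gradient being a choice of representative, all this rests on its uniqueness, obtained by
  testing with smooth approximations of indicators of boxes.
\<close>

section \<open>Pointwise inequalities\<close>

text \<open>\<open>u\<close> itself is of no use as a competitor: its gradient need not be square
  integrable, so its relaxed energy may be infinite. Passing to \<open>w\<close> changes the linear
  term, and \<open>f\<close> is merely a bounded functional, without a local representation that
  would make \<open>f u - f w\<close> visibly small. Minimality has to supply this. With
  \<open>z = 2u - w\<close> linearity gives \<open>f z - f u = f u - f w\<close>, so comparing
  \<open>u\<close> with \<open>z\<close> bounds \<open>f u - f w\<close> by a difference of gradient
  integrals, and the energy is never differentiated. The level of truncation is the largest one
  whose guaranteed gradient cap \<open>c * s\<close> does not exceed \<open>\<epsilon>p\<close>; an
  error of order \<open>s powr (p - q)\<close> then has exactly the scaling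
  \<open>\<epsilon>p powr (- (q - p))\<close> of the claim, and the factor
  \<open>c powr (q - p)\<close> goes into the constant. Because \<open>wgrad\<close> is chosen by
  \<open>SOME\<close>, the gradient of a combination is the combination of the gradients only almost
  everywhere, and even that is available only once uniqueness is known.\<close>

lemma powr_add_le_add_powr:
  fixes a b \<theta> :: real
  assumes "0 \<le> a" "0 \<le> b" "0 < \<theta>" "\<theta> \<le> 1"
  shows "(a + b) powr \<theta> \<le> a powr \<theta> + b powr \<theta>"
proof (cases "a + b = 0")
  case True
  then show ?thesis using assms by (simp add: add_nonneg_eq_0_iff)
next
  case False
  then have pos: "a + b > 0" using assms by linarith
  \<comment> \<open>After division by \<open>a + b\<close> both summands lie in [0, 1], where a
    power with exponent at most 1 can only increase them.\<close>
  have frac: "x \<le> x powr \<theta>" if "0 \<le> x" "x \<le> 1" for x :: real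
  proof (cases "x = 0")
    case False
    then show ?thesis using powr_mono'[of \<theta> 1 x] that assms by simp
  qed auto
  have "1 = a / (a + b) + b / (a + b)"
    using pos by (simp add: add_divide_distrib[symmetric])
  also have "\<dots> \<le> (a / (a + b)) powr \<theta> + (b / (a + b)) powr \<theta>"
    using assms pos by (intro add_mono frac) auto
  also have "\<dots> = (a powr \<theta> + b powr \<theta>) / (a + b) powr \<theta>"
    using assms by (simp add: powr_divide add_divide_distrib)
  finally show ?thesis
    using pos by (simp add: pos_le_divide_eq)
qed

text \<open>Midpoint concavity of the power \<open>\<theta>\<close>, read off from convexity of the
  inverse power \<open>1/\<theta>\<close> at \<open>X\<close> and \<open>Y\<close>.\<close>

lemma powr_mean_le:
  fixes x y \<theta> :: real
  assumes "0 \<le> x" "0 \<le> y" "0 < \<theta>" "\<theta> \<le> 1"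
  shows "x powr \<theta> + y powr \<theta> \<le> 2 * ((x + y) / 2) powr \<theta>"
proof -
  define X Y where "X = x powr \<theta>" and "Y = y powr \<theta>"
  have XY: "0 \<le> X" "0 \<le> Y" "x = X powr (1/\<theta>)" "y = Y powr (1/\<theta>)"
    using assms by (auto simp: X_def Y_def powr_powr)
  have "((X + Y) / 2) powr (1/\<theta>) \<le> (X powr (1/\<theta>) + Y powr (1/\<theta>)) / 2"
  proof (cases "X = 0 \<or> Y = 0")
    case False
    then have "X > 0" "Y > 0" using XY by auto
    then show ?thesis
      using convex_onD[OF powr_convex[of "1/\<theta>"], of "1/2" X Y] assms
      by (simp add: field_simps)
  next
    \<comment> \<open>If one argument vanishes, the claim reduces to
      \<open>(1/2) powr (1/\<theta>) \<le> 1/2\<close>.\<close>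
    case True
    have "(z / 2) powr (1/\<theta>) \<le> z powr (1/\<theta>) / 2" if "0 \<le> z" for z :: real
    proof -
      have "(1/2::real) powr (1/\<theta>) \<le> (1/2) powr 1"
        using assms by (intro powr_mono') auto
      then show ?thesis
        using that mult_left_mono[of "(1/2) powr (1/\<theta>)" "1/2" "z powr (1/\<theta>)"]
        by (simp add: powr_divide)
    qed
    then show ?thesis using True XY(1,2) by auto
  qed
  then have "(X + Y) / 2 \<le> ((x + y) / 2) powr \<theta>"
    using powr_mono2[of \<theta> "((X + Y) / 2) powr (1/\<theta>)" "(x + y) / 2"] XY assms
    by (simp add: powr_powr)
  then show ?thesis by (simp add: X_def Y_def)
qed

text \<open>This replaces the Euler--Lagrange equation: second differences of \<open>|\<cdot>|\<^sup>p\<close> are controlled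
  by the increment alone, because \<open>p \<le> 2\<close>.\<close>

lemma norm_powr_second_difference:
  fixes a b :: "'a::real_inner"
  assumes "0 < p" "p \<le> 2"
  shows "norm (a + b) powr p + norm (a - b) powr p \<le> 2 * norm a powr p + 2 * norm b powr p"
proof -
  \<comment> \<open>Written with squared norms the exponent becomes \<open>p/2\<close>, which is at
    most 1: concavity applies, and the parallelogram law evaluates the mean.\<close>
  have sq: "norm z powr p = ((norm z)\<^sup>2) powr (p/2)" for z :: 'a
    using powr_powr[of "norm z" 2 "p/2"] by (simp add: powr_numeral)
  have "norm (a + b) powr p + norm (a - b) powr p
      \<le> 2 * (((norm (a + b))\<^sup>2 + (norm (a - b))\<^sup>2) / 2) powr (p/2)"
    unfolding sq by (rule powr_mean_le) (use assms in auto)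
  also have "((norm (a + b))\<^sup>2 + (norm (a - b))\<^sup>2) / 2 = (norm a)\<^sup>2 + (norm b)\<^sup>2"
    by (simp add: power2_norm_eq_inner inner_simps inner_commute)
  also have "((norm a)\<^sup>2 + (norm b)\<^sup>2) powr (p/2) \<le> norm a powr p + norm b powr p"
    unfolding sq by (rule powr_add_le_add_powr) (use assms in auto)
  finally show ?thesis by simp
qed

lemma norm_add_powr_le:
  fixes a b :: "'a::real_normed_vector"
  assumes "0 < r"
  shows "norm (a + b) powr r \<le> 2 powr r * (norm a powr r + norm b powr r)"
proof -
  have "norm (a + b) powr r \<le> (2 * max (norm a) (norm b)) powr r"
    by (rule powr_mono2) (use assms norm_triangle_ineq[of a b] in auto)
  also have "\<dots> = 2 powr r * max (norm a) (norm b) powr r"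
    by (subst powr_mult) auto
  also have "max (norm a) (norm b) powr r \<le> norm a powr r + norm b powr r"
    by (auto simp: max_def)
  finally show ?thesis by simp
qed

text \<open>Up to \<open>\<epsilon>p\<close> only the first two branches of \<open>kappa\<close>
  occur, and the quadratic one is at most its value at \<open>\<epsilon>m\<close>, which is
  \<open>\<epsilon>m powr p / p\<close>.\<close>

lemma kappa_bounds:
  assumes "0 < p" "p < 2" "0 < \<epsilon>m" "0 \<le> t" "t \<le> \<epsilon>p"
  shows "0 \<le> kappa p \<epsilon>m \<epsilon>p t" and "kappa p \<epsilon>m \<epsilon>p t \<le> t powr p / p + \<epsilon>m powr p / p"
proof -
  have p: "1/p - 1/2 \<ge> 0" using assms by (simp add: field_simps)
  show "0 \<le> kappa p \<epsilon>m \<epsilon>p t"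
    using assms p by (auto simp: kappa_def)
  have "\<epsilon>m powr (p - 2) * t\<^sup>2 \<le> \<epsilon>m powr p" if "t \<le> \<epsilon>m"
  proof -
    have "\<epsilon>m powr (p - 2) * t\<^sup>2 \<le> \<epsilon>m powr (p - 2) * \<epsilon>m\<^sup>2"
      using that assms by (intro mult_left_mono power_mono) auto
    also have "\<dots> = \<epsilon>m powr p"
      using assms by (simp add: powr_diff powr_numeral)
    finally show ?thesis .
  qed
  then have "kappa p \<epsilon>m \<epsilon>p t \<le> \<epsilon>m powr p / p" if "t \<le> \<epsilon>m"
    using that by (simp add: kappa_def algebra_simps)
  moreover have "0 \<le> \<epsilon>m powr p / p" "0 \<le> t powr p / p" using assms by auto
  ultimately show "kappa p \<epsilon>m \<epsilon>p t \<le> t powr p / p + \<epsilon>m powr p / p"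
  proof (cases "t \<le> \<epsilon>m")
    case False
    then show ?thesis using assms \<open>0 \<le> \<epsilon>m powr p / p\<close> by (simp add: kappa_def)
  qed linarith
qed

section \<open>Smooth functions with compact support\<close>

text \<open>\<open>flat 0\<close> is the classical smooth function exp(-1/t), cut off at 0; the
  powers of 1/t are those that its derivatives produce.\<close>

definition flat :: "nat \<Rightarrow> real \<Rightarrow> real" where
  "flat n t = (if 0 < t then exp (- 1 / t) / t ^ n else 0)"

text \<open>With y = 1/t the limit from the right is that of y^n / exp y at infinity.\<close>

lemma flat_tendsto_0: "(flat n \<longlongrightarrow> 0) (at 0)"
proof -
  have "((\<lambda>t. (1/t) ^ n / exp (1/t)) \<longlongrightarrow> (0::real)) (at_right 0)"
    by (rule filterlim_compose[OF tendsto_power_div_exp_0])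
       (simp add: filterlim_inverse_at_top_right inverse_eq_divide[symmetric])
  then have "(flat n \<longlongrightarrow> 0) (at_right 0)"
    by (rule Lim_transform_eventually)
       (auto simp: eventually_at_right_field flat_def exp_minus field_simps intro!: exI[of _ 1])
  moreover have "(flat n \<longlongrightarrow> 0) (at_left 0)"
    by (rule Lim_transform_eventually[of "\<lambda>_. 0"])
       (auto simp: eventually_at_left_field flat_def intro!: exI[of _ "-1"])
  ultimately show ?thesis by (simp add: filterlim_at_split)
qed

lemma has_real_derivative_flat:
  "(flat n has_real_derivative (flat (n + 2) t - real n * flat (n + 1) t)) (at t)"
proof -
  consider "t < 0" | "t = 0" | "0 < t" by linarith
  then show ?thesis
  proof cases
    case 1
    have "((\<lambda>_. 0) has_real_derivative 0) (at t)" by simp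
    then show ?thesis
      using 1 has_field_derivative_transform_within_open[of "\<lambda>_. 0" 0 t "{..<0}" "flat n"]
      by (simp add: flat_def)
  next
    case 2
    \<comment> \<open>At 0 the difference quotient is again a member of the family, namely
      \<open>flat (Suc n)\<close>.\<close>
    have "((\<lambda>h. flat n h / h) \<longlongrightarrow> 0) (at 0)"
      by (rule Lim_transform_eventually[OF flat_tendsto_0[of "Suc n"]])
         (auto simp: flat_def eventually_at_filter)
    then show ?thesis using 2 by (simp add: DERIV_def flat_def)
  next
    case 3
    have "((\<lambda>t. exp (- 1 / t) / t ^ n) has_real_derivative (flat (n + 2) t - real n * flat (n + 1) t)) (at t)"
      using 3 by (auto intro!: derivative_eq_intros simp: flat_def field_simps power2_eq_square)
         (cases n; simp add: field_simps)
    then show ?thesis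
      by (rule has_field_derivative_transform_within_open[of _ _ _ "{0<..}"])
         (use 3 in \<open>auto simp: flat_def\<close>)
  qed
qed

text \<open>Because \<open>flat n\<close> differentiates to a combination of \<open>flat (n + 2)\<close> and \<open>flat (n + 1)\<close>, this
  algebra is closed under directional derivatives, which yields smoothness of all orders at once.\<close>

inductive_set smooth_gen :: "('a::euclidean_space \<Rightarrow> real) set" where
  const: "(\<lambda>x. c) \<in> smooth_gen"
| flat: "(\<lambda>x. flat n (x \<bullet> b + a)) \<in> smooth_gen"
| add: "f \<in> smooth_gen \<Longrightarrow> g \<in> smooth_gen \<Longrightarrow> (\<lambda>x. f x + g x) \<in> smooth_gen"
| mult: "f \<in> smooth_gen \<Longrightarrow> g \<in> smooth_gen \<Longrightarrow> (\<lambda>x. f x * g x) \<in> smooth_gen"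

text \<open>Closure is formulated for each fixed direction \<open>h\<close> because
  \<open>Ck\<close> recurses on directional derivatives.\<close>

lemma smooth_gen_derivative:
  assumes "f \<in> smooth_gen"
  shows "\<exists>f'. (\<forall>x. (f has_derivative f' x) (at x)) \<and> (\<forall>h. (\<lambda>x. f' x h) \<in> smooth_gen)"
  using assms
proof induction
  case (const c)
  show ?case by (intro exI[of _ "\<lambda>_ _. 0"]) (auto intro: smooth_gen.const)
next
  case (flat n b a)
  define f' where "f' x h = (flat (n + 2) (x \<bullet> b + a) + (- real n) * flat (n + 1) (x \<bullet> b + a)) * (h \<bullet> b)"
    for x h :: 'a
  have "((\<lambda>x. flat n (x \<bullet> b + a)) has_derivative f' x) (at x)" for x
  proof -
    have "((\<lambda>x. x \<bullet> b + a) has_derivative (\<lambda>h. h \<bullet> b)) (at x)"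
      by (auto intro!: derivative_eq_intros)
    from has_derivative_compose[OF this has_real_derivative_flat[of n, unfolded has_field_derivative_def]]
    show ?thesis
      by (rule has_derivative_eq_rhs) (auto simp: f'_def fun_eq_iff algebra_simps)
  qed
  moreover have "(\<lambda>x. f' x h) \<in> smooth_gen" for h
    unfolding f'_def by (intro smooth_gen.intros)
  ultimately show ?case by blast
next
  case (add f g)
  then obtain f' g' where "\<And>x. (f has_derivative f' x) (at x)" "\<And>h. (\<lambda>x. f' x h) \<in> smooth_gen"
    "\<And>x. (g has_derivative g' x) (at x)" "\<And>h. (\<lambda>x. g' x h) \<in> smooth_gen" by metis
  then show ?case
    by (intro exI[of _ "\<lambda>x h. f' x h + g' x h"]) (auto intro: has_derivative_add smooth_gen.add)
next
  case (mult f g)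
  then obtain f' g' where fg: "\<And>x. (f has_derivative f' x) (at x)" "\<And>h. (\<lambda>x. f' x h) \<in> smooth_gen"
    "\<And>x. (g has_derivative g' x) (at x)" "\<And>h. (\<lambda>x. g' x h) \<in> smooth_gen" by metis
  then show ?case
    using mult.hyps
    by (intro exI[of _ "\<lambda>x h. f x * g' x h + f' x h * g x"])
       (auto intro!: has_derivative_mult smooth_gen.add smooth_gen.mult)
qed

lemma smooth_gen_Ck: "f \<in> smooth_gen \<Longrightarrow> Ck k f"
proof (induction k arbitrary: f)
  case 0
  then obtain f' where "\<And>x. (f has_derivative f' x) (at x)"
    using smooth_gen_derivative by blast
  then show ?case
    by (auto intro!: continuous_at_imp_continuous_on has_derivative_continuous)
next
  case (Suc k)
  obtain f' where f': "\<And>x. (f has_derivative f' x) (at x)" "\<And>h. (\<lambda>x. f' x h) \<in> smooth_gen"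
    using smooth_gen_derivative[OF Suc.prems] by blast
  have "frechet_derivative f (at x) = f' x" for x
    using frechet_derivative_at[OF f'(1)] by simp
  then show ?case using f' Suc.IH by (auto simp: differentiable_def)
qed

text \<open>A tensor product of one-dimensional bumps. As the steepness \<open>m\<close> grows, each
  factor tends to 1 wherever its argument is positive, so the indicator of the open box is
  approximated from below.\<close>

definition box_bump :: "real \<Rightarrow> 'a::euclidean_space \<Rightarrow> 'a \<Rightarrow> 'a \<Rightarrow> real" where
  "box_bump m a b x = (\<Prod>i\<in>Basis. flat 0 (m * ((x - a) \<bullet> i)) * flat 0 (m * ((b - x) \<bullet> i)))"

lemma box_bump_smooth: "box_bump m a b \<in> smooth_gen"
proof -
  have prod: "(\<lambda>x. \<Prod>i\<in>I. h i x) \<in> smooth_gen" if "finite I" "\<And>i. h i \<in> smooth_gen"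
    for I :: "'a set" and h :: "'a \<Rightarrow> 'a \<Rightarrow> real"
    using that by (induction rule: finite_induct) (auto intro: smooth_gen.intros)
  have "(\<lambda>x. flat 0 (m * ((x - a) \<bullet> i))) \<in> smooth_gen" for i :: 'a
    using smooth_gen.flat[of 0 "m *\<^sub>R i" "- (m * (a \<bullet> i))"] by (simp add: inner_diff_left algebra_simps)
  moreover have "(\<lambda>x. flat 0 (m * ((b - x) \<bullet> i))) \<in> smooth_gen" for i :: 'a
    using smooth_gen.flat[of 0 "- (m *\<^sub>R i)" "m * (b \<bullet> i)"] by (simp add: inner_diff_left algebra_simps)
  ultimately have "(\<lambda>x. \<Prod>i\<in>Basis. flat 0 (m * ((x - a) \<bullet> i)) * flat 0 (m * ((b - x) \<bullet> i))) \<in> smooth_gen"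
    by (intro prod smooth_gen.mult) auto
  then show ?thesis by (simp add: box_bump_def[abs_def])
qed

lemma flat_0_bounds: "0 \<le> flat 0 t" "flat 0 t \<le> 1"
  by (auto simp: flat_def)

lemma box_bump_bounds: "0 \<le> box_bump m a b x" "box_bump m a b x \<le> 1"
  unfolding box_bump_def
  by (auto intro!: prod_nonneg prod_le_1 mult_nonneg_nonneg mult_le_one flat_0_bounds)

lemma box_bump_eq_0:
  assumes "0 < m" "x \<notin> box a b"
  shows "box_bump m a b x = 0"
proof -
  obtain i where i: "i \<in> Basis" "x \<bullet> i \<le> a \<bullet> i \<or> b \<bullet> i \<le> x \<bullet> i"
    using assms by (auto simp: mem_box not_less)
  then have "\<not> 0 < m * ((x - a) \<bullet> i) \<or> \<not> 0 < m * ((b - x) \<bullet> i)"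
    using assms by (auto simp: inner_diff_left zero_less_mult_iff)
  then have "flat 0 (m * ((x - a) \<bullet> i)) * flat 0 (m * ((b - x) \<bullet> i)) = 0"
    by (auto simp: flat_def)
  then show ?thesis unfolding box_bump_def using i by (intro prod_zero) auto
qed

lemma box_bump_tendsto:
  "(\<lambda>n. box_bump (real (Suc n)) a b x) \<longlonglongrightarrow> indicat_real (box a b) x"
proof (cases "x \<in> box a b")
  case True
  have lim: "(\<lambda>n. flat 0 (real (Suc n) * t)) \<longlonglongrightarrow> 1" if "0 < t" for t
  proof -
    have "(\<lambda>n. exp (- (inverse t * inverse (real (Suc n))))) \<longlonglongrightarrow> exp (- (inverse t * 0))"
      by (intro tendsto_intros LIMSEQ_inverse_real_of_nat)
    then show ?thesis
      using that by (simp add: flat_def field_simps del: of_nat_Suc)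
  qed
  have "(\<lambda>n. box_bump (real (Suc n)) a b x) \<longlonglongrightarrow> (\<Prod>i\<in>(Basis :: 'a set). 1 * 1)"
    unfolding box_bump_def using True
    by (intro tendsto_prod tendsto_mult lim) (auto simp: mem_box inner_diff_left)
  then show ?thesis using True by simp
next
  case False
  then show ?thesis by (simp add: box_bump_eq_0)
qed

lemma box_bump_test_function:
  assumes "0 < m" "cbox a b \<subseteq> \<Omega>"
  shows "box_bump m a b \<in> test_functions \<Omega>"
proof -
  have "{x. box_bump m a b x \<noteq> 0} \<subseteq> cbox a b"
    using box_bump_eq_0[OF assms(1)] box_subset_cbox by blast
  then have "closure {x. box_bump m a b x \<noteq> 0} \<subseteq> cbox a b"
    by (rule closure_minimal) (rule closed_cbox)
  then show ?thesis
    using assms smooth_gen_Ck[OF box_bump_smooth]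
    by (auto simp: test_functions_def bounded_subset[OF bounded_cbox] compact_eq_bounded_closed)
qed

section \<open>Linearity, continuity and supports of test functions\<close>

lemma Ck_linear: "Ck k f \<Longrightarrow> Ck k g \<Longrightarrow> Ck k (\<lambda>x. a *\<^sub>R f x + b *\<^sub>R g x)"
proof (induction k arbitrary: f g)
  case 0
  then show ?case by (auto intro!: continuous_intros)
next
  case (Suc k)
  have d: "((\<lambda>x. a *\<^sub>R f x + b *\<^sub>R g x) has_derivative
      (\<lambda>h. a *\<^sub>R frechet_derivative f (at x) h + b *\<^sub>R frechet_derivative g (at x) h)) (at x)" for x
    using Suc.prems by (auto intro!: derivative_intros simp: frechet_derivative_works[THEN iffD1])
  then have "frechet_derivative (\<lambda>x. a *\<^sub>R f x + b *\<^sub>R g x) (at x) =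
      (\<lambda>h. a *\<^sub>R frechet_derivative f (at x) h + b *\<^sub>R frechet_derivative g (at x) h)" for x
    by (rule frechet_derivative_at[symmetric])
  moreover have "(\<lambda>x. a *\<^sub>R f x + b *\<^sub>R g x) differentiable (at x)" for x
    using d by (rule differentiableI)
  ultimately show ?case using Suc by simp
qed

lemma test_functions_linear:
  assumes "\<phi> \<in> test_functions \<Omega>" "\<psi> \<in> test_functions \<Omega>"
  shows "(\<lambda>x. a * \<phi> x + b * \<psi> x) \<in> test_functions \<Omega>"
proof -
  let ?A = "closure {x. \<phi> x \<noteq> 0}" and ?B = "closure {x. \<psi> x \<noteq> 0}"
  let ?C = "closure {x. a * \<phi> x + b * \<psi> x \<noteq> 0}"
  have AB: "compact (?A \<union> ?B)" "?A \<union> ?B \<subseteq> \<Omega>"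
    using assms by (auto simp: test_functions_def)
  have "{x. a * \<phi> x + b * \<psi> x \<noteq> 0} \<subseteq> {x. \<phi> x \<noteq> 0} \<union> {x. \<psi> x \<noteq> 0}"
    by auto
  also have "\<dots> \<subseteq> ?A \<union> ?B"
    by (intro Un_mono closure_subset)
  finally have C: "?C \<subseteq> ?A \<union> ?B"
    by (rule closure_minimal) (rule closed_Un; rule closed_closure)
  have "compact ?C"
    using C AB(1) by (meson bounded_subset closed_closure compact_eq_bounded_closed)
  then show ?thesis
    using Ck_linear[of _ \<phi> \<psi> a b] assms C AB by (auto simp: test_functions_def)
qed

lemma test_function_continuous:
  assumes "\<phi> \<in> test_functions \<Omega>"
  shows "continuous_on UNIV \<phi>" "continuous_on UNIV (\<lambda>x. frechet_derivative \<phi> (at x) h)"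
    "(\<phi> has_derivative frechet_derivative \<phi> (at x)) (at x)"
proof -
  have "Ck 0 \<phi>" "Ck (Suc 0) \<phi>" using assms unfolding test_functions_def by blast+
  then show "continuous_on UNIV \<phi>" "continuous_on UNIV (\<lambda>x. frechet_derivative \<phi> (at x) h)"
    "(\<phi> has_derivative frechet_derivative \<phi> (at x)) (at x)"
    by (auto simp: frechet_derivative_works)
qed

text \<open>One compact set serves for the function and its directional derivatives: off the closed
  support the function vanishes on an open neighbourhood.\<close>

lemma test_function_support:
  assumes "\<phi> \<in> test_functions \<Omega>"
  obtains K where "compact K" "K \<subseteq> \<Omega>" "\<And>x. x \<notin> K \<Longrightarrow> \<phi> x = 0"
    "\<And>x h. x \<notin> K \<Longrightarrow> frechet_derivative \<phi> (at x) h = 0"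
proof -
  define K where "K = closure {x. \<phi> x \<noteq> 0}"
  have K: "compact K" "K \<subseteq> \<Omega>" using assms unfolding test_functions_def K_def by blast+
  have zero: "\<phi> x = 0" if "x \<notin> K" for x
    using that closure_subset[of "{x. \<phi> x \<noteq> 0}"] unfolding K_def[symmetric] by blast
  have "frechet_derivative \<phi> (at x) h = 0" if "x \<notin> K" for x h
  proof -
    have "((\<lambda>_. 0) has_derivative (\<lambda>_. 0)) (at x)" by simp
    then have "(\<phi> has_derivative (\<lambda>_. 0)) (at x)"
      by (rule has_derivative_transform_within_open[of _ _ _ _ "- K"])
         (use that zero K(1) in \<open>auto simp: compact_imp_closed open_Compl\<close>)
    from fun_cong[OF frechet_derivative_at[OF this], of h] show ?thesis by simp
  qed
  then show thesis using K zero that by blast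
qed

text \<open>Translation invariance makes the integrals of the difference quotients vanish.\<close>

lemma integral_directional_derivative_eq_0:
  fixes F :: "'a::euclidean_space \<Rightarrow> real"
  assumes der: "\<And>x. (F has_derivative F' x) (at x)" and cont: "continuous_on UNIV (\<lambda>x. F' x i)"
    and K: "compact K" "\<And>x. x \<notin> K \<Longrightarrow> F x = 0" "\<And>x. x \<notin> K \<Longrightarrow> F' x i = 0"
  shows "(LINT x|lebesgue. F' x i) = 0"
proof -
  have contF: "continuous_on UNIV F"
    by (intro continuous_at_imp_continuous_on ballI has_derivative_continuous[OF der])
  have [measurable]: "F \<in> borel_measurable borel" "(\<lambda>x. F' x i) \<in> borel_measurable borel"
    using contF cont by (auto intro: borel_measurable_continuous_onI)
  have "bounded ((\<lambda>x. F' x i) ` K)"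
    using cont K by (intro compact_imp_bounded compact_continuous_image) (auto intro: continuous_on_subset)
  then obtain C where C: "\<And>x. x \<in> K \<Longrightarrow> \<bar>F' x i\<bar> \<le> C" "0 < C"
    unfolding bounded_pos by auto
  then have C: "\<bar>F' x i\<bar> \<le> C" for x using K(3)[of x] by (cases "x \<in> K") auto
  obtain R where R: "\<And>x. x \<in> K \<Longrightarrow> norm x \<le> R" using compact_imp_bounded[OF K(1)] unfolding bounded_pos by auto
  have intF: "integrable lborel F"
  proof -
    have "integrable lborel (\<lambda>x. indicator K x *\<^sub>R F x)"
      using borel_integrable_compact[OF K(1), of F] contF by (auto intro: continuous_on_subset)
    also have "(\<lambda>x. indicator K x *\<^sub>R F x) = F"
      by (rule ext, case_tac "x \<in> K") (auto simp: K(2))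
    finally show ?thesis .
  qed
  define q where "q n x = (F (x + (1 / real (Suc n)) *\<^sub>R i) - F x) * real (Suc n)" for n x
  have [measurable]: "q n \<in> borel_measurable borel" for n unfolding q_def by measurable
  \<comment> \<open>By the mean value theorem the difference quotient is a value of the derivative
    at a nearby point. This yields both the uniform bound \<open>C\<close> and the pointwise
    convergence.\<close>
  have q: "\<exists>s\<ge>0. s \<le> 1 / real (Suc n) \<and> q n x = F' (x + s *\<^sub>R i) i" for n x
  proof -
    have "((\<lambda>t. F (x + t *\<^sub>R i)) has_real_derivative F' (x + t *\<^sub>R i) i) (at t)" for t
    proof -
      have "((\<lambda>t. x + t *\<^sub>R i) has_derivative (\<lambda>h. h *\<^sub>R i)) (at t)"
        by (auto intro!: derivative_eq_intros)
      from has_derivative_compose[OF this der]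
      have "((\<lambda>t. F (x + t *\<^sub>R i)) has_derivative (\<lambda>h. F' (x + t *\<^sub>R i) (h *\<^sub>R i))) (at t)" .
      moreover have "F' y (h *\<^sub>R i) = F' y i * h" for y h
        using linear_scale[OF has_derivative_linear[OF der[of y]], of h i] by simp
      ultimately show ?thesis by (simp add: has_field_derivative_def)
    qed
    then obtain s where s: "0 < s \<and> s < 1 / real (Suc n) \<and>
      F (x + (1 / real (Suc n)) *\<^sub>R i) - F (x + 0 *\<^sub>R i) = (1 / real (Suc n) - 0) * F' (x + s *\<^sub>R i) i"
      using MVT2[of 0 "1 / real (Suc n)" "\<lambda>t. F (x + t *\<^sub>R i)" "\<lambda>t. F' (x + t *\<^sub>R i) i"]
      by fastforce
    then have "q n x = F' (x + s *\<^sub>R i) i"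
      by (simp add: q_def del: of_nat_Suc)
    then show ?thesis using s by (intro exI[of _ s]) auto
  qed
  have int_q: "(LINT x|lborel. q n x) = 0" for n
  proof -
    have eq: "lborel = distr lborel borel (\<lambda>x. x + (1 / real (Suc n)) *\<^sub>R i)"
    proof -
      have "(\<lambda>x. x + (1 / real (Suc n)) *\<^sub>R i) = (+) ((1 / real (Suc n)) *\<^sub>R i)"
        by (simp add: fun_eq_iff add.commute)
      then show ?thesis by (simp add: lborel_distr_plus del: of_nat_Suc)
    qed
    have "integrable lborel (\<lambda>x. F (x + (1 / real (Suc n)) *\<^sub>R i))"
      using intF by (subst (asm) eq) (subst (asm) integrable_distr_eq; simp)
    moreover have "(LINT x|lborel. F (x + (1 / real (Suc n)) *\<^sub>R i)) = (LINT x|lborel. F x)"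
      by (subst (2) eq, subst integral_distr) auto
    ultimately show ?thesis using intF by (simp add: q_def)
  qed
  have "(\<lambda>n. LINT x|lborel. q n x) \<longlonglongrightarrow> (LINT x|lborel. F' x i)"
  \<comment> \<open>The increments have length at most \<open>norm i\<close>, so all quotients
    vanish outside the ball of radius \<open>R + norm i\<close>.\<close>
  proof (rule integral_dominated_convergence[where w = "\<lambda>x. C * indicator (cball 0 (R + norm i)) x"])
    show "integrable lborel (\<lambda>x. C * indicator (cball 0 (R + norm i)) x)"
      by (intro integrable_mult_right integrable_real_indicator)
         (use emeasure_lborel_cball_finite[of 0 "R + norm i"] in auto)
    show "AE x in lborel. (\<lambda>n. q n x) \<longlonglongrightarrow> F' x i"
    proof (rule AE_I2)
      fix x
      have "\<forall>n. \<exists>s. 0 \<le> s \<and> s \<le> 1 / real (Suc n) \<and> q n x = F' (x + s *\<^sub>R i) i"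
        using q by blast
      from choice[OF this]
      obtain s where s: "0 \<le> s n" "s n \<le> 1 / real (Suc n)" "q n x = F' (x + s n *\<^sub>R i) i" for n
        by blast
      have "s \<longlonglongrightarrow> 0"
        by (rule tendsto_sandwich[OF _ _ tendsto_const LIMSEQ_inverse_real_of_nat])
           (use s in \<open>auto simp: inverse_eq_divide\<close>)
      then have "(\<lambda>n. x + s n *\<^sub>R i) \<longlonglongrightarrow> x + 0 *\<^sub>R i" by (intro tendsto_intros)
      then have "(\<lambda>n. F' (x + s n *\<^sub>R i) i) \<longlonglongrightarrow> F' x i"
        using cont by (intro continuous_on_tendsto_compose[OF cont]) auto
      then show "(\<lambda>n. q n x) \<longlonglongrightarrow> F' x i" using s by simp
    qed
    show "AE x in lborel. norm (q n x) \<le> C * indicator (cball 0 (R + norm i)) x" for n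
    proof (rule AE_I2)
      fix x
      obtain s where s: "0 \<le> s" "s \<le> 1 / real (Suc n)" "q n x = F' (x + s *\<^sub>R i) i"
        using q by blast
      show "norm (q n x) \<le> C * indicator (cball 0 (R + norm i)) x"
      proof (cases "x + s *\<^sub>R i \<in> K")
        case True
        have "s * norm i \<le> 1 * norm i"
          using s by (intro mult_right_mono) (auto intro: order_trans simp: divide_le_eq)
        then have "norm x \<le> R + norm i"
          using R[OF True] norm_triangle_ineq4[of "x + s *\<^sub>R i" "s *\<^sub>R i"] s by simp
        then show ?thesis using C s by simp
      next
        case False
        then show ?thesis using K(3)[OF False] s(3) \<open>0 < C\<close> by simp
      qed
    qed
  qed auto
  then have "(LINT x|lborel. F' x i) = 0"
    using int_q by (simp add: LIMSEQ_const_iff)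
  then show ?thesis by (simp add: integral_completion)
qed

section \<open>Uniqueness and linearity of weak gradients\<close>

text \<open>Dynkin argument: open boxes are stable under intersection and generate the Borel sets,
  so the integral of \<open>h\<close> vanishes over every Borel set. Up to a null set
  \<open>{x. h x > 0}\<close> is one of these, and a nonnegative function with zero integral
  vanishes almost everywhere.\<close>

lemma AE_le_0_of_box_integrals:
  fixes h :: "'a::euclidean_space \<Rightarrow> real"
  assumes h: "integrable lebesgue h" and zero: "\<And>c d. (LINT x:box c d|lebesgue. h x) = 0"
  shows "AE x in lebesgue. h x \<le> 0"
proof -
  have int_on: "set_integrable lebesgue A h" if "A \<in> sets lebesgue" for A
    using integrable_mult_indicator[OF that h] unfolding set_integrable_def .
  define G where "G = range (\<lambda>(a, b). box a b :: 'a set)"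
  have "Int_stable G" unfolding Int_stable_def
  proof safe
    fix A B assume "A \<in> G" "B \<in> G"
    then obtain a b c d where "A = box a b" "B = box c d" by (auto simp: G_def)
    then have "A \<inter> B = (\<lambda>(a, b). box a b) (\<Sum>i\<in>Basis. max (a \<bullet> i) (c \<bullet> i) *\<^sub>R i, \<Sum>i\<in>Basis. min (b \<bullet> i) (d \<bullet> i) *\<^sub>R i)"
      by (simp add: box_Int_box)
    then show "A \<inter> B \<in> G" unfolding G_def by (rule range_eqI)
  qed
  have borel_sets: "A \<in> sets lebesgue" if "A \<in> sigma_sets UNIV G" for A
  proof -
    have "A \<in> sets borel" using that unfolding G_def borel_eq_box by simp
    then show ?thesis by simp
  qed
  \<comment> \<open>Growing boxes exhaust the space; the complement step of the induction needs this
    total integral.\<close>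
  have tot: "(LINT x|lebesgue. h x) = 0"
  proof -
    have "(\<lambda>n. LINT x:box (- (real n *\<^sub>R One)) (real n *\<^sub>R One)|lebesgue. h x)
        \<longlonglongrightarrow> (LINT x:(\<Union>n. box (- (real n *\<^sub>R One)) (real n *\<^sub>R One))|lebesgue. h x)"
    proof (rule set_integral_cont_up)
      show "incseq (\<lambda>n. box (- (real n *\<^sub>R One)) (real n *\<^sub>R One :: 'a))"
        by (auto simp: incseq_def subset_box)
      show "set_integrable lebesgue (\<Union>n. box (- (real n *\<^sub>R One)) (real n *\<^sub>R One)) h"
        by (rule int_on) simp
    qed simp
    then show ?thesis
      unfolding zero UN_box_eq_UNIV
      by (simp add: LIMSEQ_const_iff set_lebesgue_integral_def)
  qed
  have borel0: "(LINT x:A|lebesgue. h x) = 0" if A: "A \<in> sets borel" for A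
  proof -
    have "G \<subseteq> Pow UNIV" by simp
    with \<open>Int_stable G\<close> have "Int_stable G" "G \<subseteq> Pow UNIV" .
    moreover have "A \<in> sigma_sets UNIV G" using A unfolding G_def borel_eq_box by simp
    ultimately show ?thesis
    proof (induction rule: sigma_sets_induct_disjoint)
      case (basic A)
      then show ?case using zero by (auto simp: G_def)
    next
      case (compl A)
      have "(LINT x:UNIV|lebesgue. h x) = (LINT x:A \<union> (UNIV - A)|lebesgue. h x)" by simp
      also have "\<dots> = (LINT x:A|lebesgue. h x) + (LINT x:UNIV - A|lebesgue. h x)"
        using borel_sets[OF compl(1)] by (intro set_integral_Un int_on) auto
      finally show ?case using compl tot by (simp add: set_lebesgue_integral_def)
    next
      case (union A)
      have "(LINT x:(\<Union>i. A i)|lebesgue. h x) = (\<Sum>i. (LINT x:A i|lebesgue. h x))"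
      proof (rule lebesgue_integral_countable_add)
        show "A i \<in> sets lebesgue" for i using union(2) borel_sets by auto
        then show "set_integrable lebesgue (\<Union>i. A i) h" by (intro int_on) auto
      qed (use union(1) in \<open>auto simp: disjoint_family_on_def\<close>)
      then show ?case using union by simp
    qed (auto simp: set_lebesgue_integral_def)
  qed
  have hm[measurable]: "h \<in> borel_measurable lebesgue" using h by auto
  define P where "P = {x. h x > 0}"
  have P[measurable]: "P \<in> sets lebesgue"
    using measurable_sets[OF hm, of "{0<..}"] by (simp add: P_def vimage_def)
  \<comment> \<open>\<open>P\<close> is only Lebesgue measurable, while the induction reaches Borel
    sets; the two differ here by a negligible set.\<close>
  obtain B N where BN: "B \<in> sets borel" "negligible N" "B \<union> N = P"
    using sets_lebesgue_almost_borel[OF P] .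
  have "AE x in lebesgue. x \<notin> N"
    using BN(2) by (simp add: negligible_iff_null_sets AE_not_in)
  then have "AE x in lebesgue. indicat_real P x *\<^sub>R h x = indicat_real B x *\<^sub>R h x"
    by eventually_elim (use BN in \<open>auto simp: indicator_def\<close>)
  then have "(LINT x:P|lebesgue. h x) = (LINT x:B|lebesgue. h x)"
    unfolding set_lebesgue_integral_def using BN(1)
    by (intro integral_cong_AE borel_measurable_scaleR borel_measurable_indicator hm) auto
  also have "\<dots> = 0" by (rule borel0[OF BN(1)])
  finally have "(LINT x|lebesgue. indicat_real P x *\<^sub>R h x) = 0"
    by (simp add: set_lebesgue_integral_def)
  then have "AE x in lebesgue. indicat_real P x *\<^sub>R h x = 0"
    using int_on[OF P] unfolding set_integrable_def
    by (subst (asm) integral_nonneg_eq_0_iff_AE) (auto simp: indicator_def P_def)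
  then show ?thesis by eventually_elim (auto simp: P_def indicator_def split: if_splits)
qed

lemma AE_eq_0_of_box_integrals:
  fixes h :: "'a::euclidean_space \<Rightarrow> real"
  assumes h: "integrable lebesgue h" and zero: "\<And>c d. (LINT x:box c d|lebesgue. h x) = 0"
  shows "AE x in lebesgue. h x = 0"
proof -
  have "AE x in lebesgue. - h x \<le> 0"
    using h zero by (intro AE_le_0_of_box_integrals) (auto simp: set_lebesgue_integral_def)
  with AE_le_0_of_box_integrals[OF h zero] show ?thesis by eventually_elim auto
qed

section \<open>Pairing locally integrable functions with test functions\<close>

lemma integrable_mult_compact_support:
  fixes v f :: "'a::euclidean_space \<Rightarrow> real"
  assumes "open \<Omega>" and v: "locally_integrable \<Omega> v" and f: "continuous_on UNIV f"
    and K: "compact K" "K \<subseteq> \<Omega>" "\<And>x. x \<notin> K \<Longrightarrow> f x = 0"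
  shows "integrable (lebesgue_on \<Omega>) (\<lambda>x. v x * f x)"
proof -
  have sets: "K \<in> sets lebesgue" "\<Omega> \<in> sets lebesgue"
    using K assms by (auto intro: lmeasurable_compact fmeasurableD)
  have vK: "integrable (lebesgue_on K) v" using v K by (auto simp: locally_integrable_def)
  have "bounded (f ` K)"
    using f K by (intro compact_imp_bounded compact_continuous_image) (auto intro: continuous_on_subset)
  then obtain C where C: "\<And>x. x \<in> K \<Longrightarrow> \<bar>f x\<bar> \<le> C" "0 < C"
    unfolding bounded_pos by auto
  then have C: "\<bar>f x\<bar> \<le> C" for x using K(3)[of x] by (cases "x \<in> K") auto
  have [measurable]: "f \<in> borel_measurable (lebesgue_on K)"
    using f by (intro measurable_restrict_space1 measurable_completion) (simp add: borel_measurable_continuous_onI)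
  have [measurable]: "v \<in> borel_measurable (lebesgue_on K)" using vK by auto
  have "integrable (lebesgue_on K) (\<lambda>x. v x * f x)"
  proof (rule Bochner_Integration.integrable_bound)
    show "integrable (lebesgue_on K) (\<lambda>x. v x * C)" using vK by simp
    show "AE x in lebesgue_on K. norm (v x * f x) \<le> norm (v x * C)"
      using C by (intro AE_I2) (auto simp: abs_mult intro!: mult_left_mono order_trans[OF C abs_ge_self])
  qed measurable
  then have "integrable lebesgue (\<lambda>x. indicator K x *\<^sub>R (v x * f x))"
    using sets by (subst (asm) integrable_restrict_space) auto
  also have "(\<lambda>x. indicator K x *\<^sub>R (v x * f x)) = (\<lambda>x. indicator \<Omega> x *\<^sub>R (v x * f x))"
    by (rule ext, case_tac "x \<in> K") (use K in \<open>auto simp: K(3)\<close>)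
  finally show ?thesis
    using sets by (subst integrable_restrict_space) auto
qed

text \<open>Fundamental lemma of the calculus of variations. Local integrability controls
  \<open>D\<close> only on compact sets, so the argument runs on closed boxes inside
  \<open>\<Omega>\<close>, countably many of which cover \<open>\<Omega>\<close>.\<close>

lemma test_integrals_zero_imp_AE_0:
  fixes D :: "'a::euclidean_space \<Rightarrow> real"
  assumes \<Omega>: "open \<Omega>" and D: "locally_integrable \<Omega> D"
    and zero: "\<And>\<phi>. \<phi> \<in> test_functions \<Omega> \<Longrightarrow> (LINT x|lebesgue_on \<Omega>. D x * \<phi> x) = 0"
  shows "AE x in lebesgue_on \<Omega>. D x = 0"
proof -
  have \<Omega>_sets: "\<Omega> \<in> sets lebesgue" using \<Omega> by auto
  have int: "integrable lebesgue (\<lambda>x. indicat_real (cbox a b) x * D x)" if "cbox a b \<subseteq> \<Omega>" for a b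
  proof -
    have "integrable (lebesgue_on (cbox a b)) D"
      using D that by (auto simp: locally_integrable_def)
    then show ?thesis by (subst (asm) integrable_restrict_space) auto
  qed
  have box0: "(LINT x:box a b|lebesgue. D x) = 0" if ab: "cbox a b \<subseteq> \<Omega>" for a b
  proof -
    \<comment> \<open>Cutting \<open>D\<close> off to the closed box makes it globally integrable,
      and its absolute value dominates all products with bumps.\<close>
    define h where "h x = indicat_real (cbox a b) x * D x" for x
    have hm[measurable]: "h \<in> borel_measurable lebesgue"
      using int[OF ab] unfolding h_def[abs_def] by auto
    have bm[measurable]: "box_bump m a b \<in> borel_measurable lebesgue" for m
      using test_function_continuous(1)[of "box_bump m a b" UNIV] smooth_gen_Ck[OF box_bump_smooth, of 0 m a b]
      by (intro measurable_completion) (simp add: borel_measurable_continuous_onI)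
    have "(\<lambda>n. LINT x|lebesgue. h x * box_bump (real (Suc n)) a b x)
        \<longlonglongrightarrow> (LINT x|lebesgue. h x * indicat_real (box a b) x)"
    proof (rule integral_dominated_convergence[where w = "\<lambda>x. \<bar>h x\<bar>"])
      show "AE x in lebesgue. (\<lambda>n. h x * box_bump (real (Suc n)) a b x) \<longlonglongrightarrow> h x * indicat_real (box a b) x"
        by (intro AE_I2 tendsto_mult tendsto_const box_bump_tendsto)
      show "AE x in lebesgue. norm (h x * box_bump (real (Suc n)) a b x) \<le> \<bar>h x\<bar>" for n
        by (intro AE_I2) (simp add: abs_mult box_bump_bounds mult_left_le del: of_nat_Suc)
      show "integrable lebesgue (\<lambda>x. \<bar>h x\<bar>)" using int[OF ab] by (simp add: h_def)
      show "(\<lambda>x. h x * box_bump (real (Suc n)) a b x) \<in> borel_measurable lebesgue" for n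
        by (intro borel_measurable_times hm bm)
      show "(\<lambda>x. h x * indicat_real (box a b) x) \<in> borel_measurable lebesgue"
        by (intro borel_measurable_times hm borel_measurable_indicator) simp
    qed
    moreover have "(LINT x|lebesgue. h x * box_bump (real (Suc n)) a b x) = 0" for n
    proof -
      have "h x * box_bump (real (Suc n)) a b x = indicat_real \<Omega> x *\<^sub>R (D x * box_bump (real (Suc n)) a b x)" for x
      proof (cases "x \<in> box a b")
        case True
        then have "x \<in> cbox a b" using box_subset_cbox by auto
        then show ?thesis using ab by (auto simp: h_def)
      next
        case False
        have "0 < real (Suc n)" by simp
        from box_bump_eq_0[OF this False] show ?thesis by simp
      qed
      then have "(\<lambda>x. h x * box_bump (real (Suc n)) a b x)
          = (\<lambda>x. indicat_real \<Omega> x *\<^sub>R (D x * box_bump (real (Suc n)) a b x))" by (rule ext)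
      then have "(LINT x|lebesgue. h x * box_bump (real (Suc n)) a b x)
          = (LINT x|lebesgue_on \<Omega>. D x * box_bump (real (Suc n)) a b x)"
        using \<Omega>_sets by (subst integral_restrict_space) (simp_all only: Int_absorb2 space_completion space_lborel space_borel Int_UNIV_right)
      also have "\<dots> = 0" by (intro zero box_bump_test_function ab) simp
      finally show ?thesis .
    qed
    ultimately have "(LINT x|lebesgue. h x * indicat_real (box a b) x) = 0"
      by (simp add: LIMSEQ_const_iff)
    also have "(\<lambda>x. h x * indicat_real (box a b) x) = (\<lambda>x. indicat_real (box a b) x *\<^sub>R D x)"
      by (rule ext, case_tac "x \<in> box a b") (use box_subset_cbox[of a b] in \<open>auto simp: h_def\<close>)
    finally show ?thesis by (simp add: set_lebesgue_integral_def)
  qed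
  have cbox0: "AE x in lebesgue. x \<in> cbox a b \<longrightarrow> D x = 0" if ab: "cbox a b \<subseteq> \<Omega>" for a b
  proof -
    have "AE x in lebesgue. indicat_real (box a b) x * D x = 0"
    proof (rule AE_eq_0_of_box_integrals)
      have "integrable lebesgue (\<lambda>x. indicat_real (box a b) x *\<^sub>R (indicat_real (cbox a b) x * D x))"
        by (rule integrable_mult_indicator[OF _ int[OF ab]]) auto
      also have "(\<lambda>x. indicat_real (box a b) x *\<^sub>R (indicat_real (cbox a b) x * D x))
          = (\<lambda>x. indicat_real (box a b) x * D x)"
        by (rule ext, case_tac "x \<in> box a b") (use box_subset_cbox[of a b] in auto)
      finally show "integrable lebesgue (\<lambda>x. indicat_real (box a b) x * D x)" .
      fix c d
      have "(LINT x:box c d|lebesgue. indicat_real (box a b) x * D x) = (LINT x:box a b \<inter> box c d|lebesgue. D x)"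
        by (auto simp: set_lebesgue_integral_def indicator_def intro!: Bochner_Integration.integral_cong)
      also have "\<dots> = 0"
      \<comment> \<open>Nonemptiness is what permits passing to closures: if \<open>box e f\<close>
        is empty, \<open>cbox e f\<close> can still be a degenerate box lying outside
        \<open>\<Omega>\<close>.\<close>
      proof (cases "box a b \<inter> box c d = {}")
        case False
        obtain e f where ef: "box a b \<inter> box c d = box e f" using box_Int_box by blast
        have "cbox e f \<subseteq> cbox a b" using False ef
          by (metis Int_lower1 box_subset_cbox closed_cbox closure_box closure_minimal order_trans)
        then show ?thesis using ef box0[of e f] ab by auto
      qed (simp add: set_lebesgue_integral_def)
      finally show "(LINT x:box c d|lebesgue. indicat_real (box a b) x * D x) = 0" .
    qed
    moreover have "AE x in lebesgue. x \<notin> cbox a b - box a b"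
      using negligible_frontier_interval[of a b] unfolding negligible_iff_null_sets by (rule AE_not_in)
    ultimately show ?thesis by eventually_elim (auto simp: indicator_def)
  qed
  obtain \<D> where \<D>: "countable \<D>" "\<D> \<subseteq> Pow \<Omega>" "\<And>X. X \<in> \<D> \<Longrightarrow> \<exists>a b. X = cbox a b" "\<Union>\<D> = \<Omega>"
    using open_countable_Union_open_cbox[OF \<Omega>] by metis
  have "AE x in lebesgue. \<forall>X\<in>\<D>. x \<in> X \<longrightarrow> D x = 0"
    using \<D> cbox0 by (subst AE_ball_countable) (auto, blast)
  then have "AE x in lebesgue. x \<in> \<Omega> \<longrightarrow> D x = 0"
    by eventually_elim (use \<D>(4) in blast)
  then show ?thesis using \<Omega>_sets by (subst AE_restrict_space_iff) auto
qed

section \<open>Linearity and uniqueness of the weak gradient\<close>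

lemma locally_integrable_inner:
  "locally_integrable \<Omega> G \<Longrightarrow> locally_integrable \<Omega> (\<lambda>x. G x \<bullet> i)"
  by (auto simp: locally_integrable_def)

lemma locally_integrable_linear:
  "locally_integrable \<Omega> v \<Longrightarrow> locally_integrable \<Omega> w \<Longrightarrow> locally_integrable \<Omega> (\<lambda>x. a *\<^sub>R v x + b *\<^sub>R w x)"
  by (auto simp: locally_integrable_def)

text \<open>Licenses the splitting of integrals of sums: a non-integrable function has integral 0 by
  convention, so linearity of the defining identities is not automatic.\<close>

lemma weak_gradient_integrable:
  assumes "open \<Omega>" "has_weak_gradient \<Omega> v G" "\<phi> \<in> test_functions \<Omega>"
  shows "integrable (lebesgue_on \<Omega>) (\<lambda>x. v x * frechet_derivative \<phi> (at x) i)"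
    and "integrable (lebesgue_on \<Omega>) (\<lambda>x. (G x \<bullet> i) * \<phi> x)"
proof -
  obtain K where K: "compact K" "K \<subseteq> \<Omega>" "\<And>x. x \<notin> K \<Longrightarrow> \<phi> x = 0"
    "\<And>x h. x \<notin> K \<Longrightarrow> frechet_derivative \<phi> (at x) h = 0"
    using test_function_support[OF assms(3)] by metis
  note cont = test_function_continuous[OF assms(3)]
  show "integrable (lebesgue_on \<Omega>) (\<lambda>x. v x * frechet_derivative \<phi> (at x) i)"
    using assms by (intro integrable_mult_compact_support[OF _ _ cont(2) K(1,2,4)])
      (auto simp: has_weak_gradient_def)
  show "integrable (lebesgue_on \<Omega>) (\<lambda>x. (G x \<bullet> i) * \<phi> x)"
    using assms by (intro integrable_mult_compact_support[OF _ _ cont(1) K(1,2,3)])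
      (auto simp: has_weak_gradient_def intro: locally_integrable_inner)
qed

lemma has_weak_gradient_linear:
  assumes \<Omega>: "open \<Omega>" and v: "has_weak_gradient \<Omega> v G" and w: "has_weak_gradient \<Omega> w H"
  shows "has_weak_gradient \<Omega> (\<lambda>x. a * v x + b * w x) (\<lambda>x. a *\<^sub>R G x + b *\<^sub>R H x)"
  unfolding has_weak_gradient_def
proof (intro conjI ballI)
  show "locally_integrable \<Omega> (\<lambda>x. a * v x + b * w x)"
    using locally_integrable_linear[of \<Omega> v w a b] v w by (auto simp: has_weak_gradient_def)
  show "locally_integrable \<Omega> (\<lambda>x. a *\<^sub>R G x + b *\<^sub>R H x)"
    using v w by (auto simp: has_weak_gradient_def intro: locally_integrable_linear)
  fix \<phi> and i :: 'a assume \<phi>: "\<phi> \<in> test_functions \<Omega>" and i: "i \<in> Basis"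
  note int = weak_gradient_integrable[OF \<Omega> v \<phi>, of i] weak_gradient_integrable[OF \<Omega> w \<phi>, of i]
  have "(LINT x|lebesgue_on \<Omega>. (a * v x + b * w x) * frechet_derivative \<phi> (at x) i)
    = (LINT x|lebesgue_on \<Omega>. a * (v x * frechet_derivative \<phi> (at x) i) + b * (w x * frechet_derivative \<phi> (at x) i))"
    by (simp add: algebra_simps)
  also have "\<dots> = a * (LINT x|lebesgue_on \<Omega>. v x * frechet_derivative \<phi> (at x) i)
      + b * (LINT x|lebesgue_on \<Omega>. w x * frechet_derivative \<phi> (at x) i)"
    using int by simp
  also have "\<dots> = - (a * (LINT x|lebesgue_on \<Omega>. (G x \<bullet> i) * \<phi> x) + b * (LINT x|lebesgue_on \<Omega>. (H x \<bullet> i) * \<phi> x))"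
    using v w \<phi> i by (simp add: has_weak_gradient_def)
  also have "\<dots> = - (LINT x|lebesgue_on \<Omega>. a * ((G x \<bullet> i) * \<phi> x) + b * ((H x \<bullet> i) * \<phi> x))"
    using int by simp
  also have "\<dots> = - (LINT x|lebesgue_on \<Omega>. ((a *\<^sub>R G x + b *\<^sub>R H x) \<bullet> i) * \<phi> x)"
    by (simp add: inner_add_left algebra_simps)
  finally show "(LINT x|lebesgue_on \<Omega>. (a * v x + b * w x) * frechet_derivative \<phi> (at x) i)
    = - (LINT x|lebesgue_on \<Omega>. ((a *\<^sub>R G x + b *\<^sub>R H x) \<bullet> i) * \<phi> x)" .
qed

text \<open>Every coordinate of \<open>G - H\<close> pairs to 0 with all test functions, since both
  pairings equal the same integral of \<open>v\<close>.\<close>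

lemma has_weak_gradient_unique:
  assumes \<Omega>: "open \<Omega>" and v: "has_weak_gradient \<Omega> v G" "has_weak_gradient \<Omega> v H"
  shows "AE x in lebesgue_on \<Omega>. G x = H x"
proof -
  have "AE x in lebesgue_on \<Omega>. (G x - H x) \<bullet> i = 0" if i: "i \<in> Basis" for i
  proof (rule test_integrals_zero_imp_AE_0[OF \<Omega>])
    have "locally_integrable \<Omega> (\<lambda>x. 1 *\<^sub>R G x + (- 1) *\<^sub>R H x)"
      using v by (intro locally_integrable_linear) (auto simp: has_weak_gradient_def)
    then show "locally_integrable \<Omega> (\<lambda>x. (G x - H x) \<bullet> i)"
      by (intro locally_integrable_inner) simp
    fix \<phi> assume \<phi>: "\<phi> \<in> test_functions \<Omega>"
    have "(LINT x|lebesgue_on \<Omega>. ((G x - H x) \<bullet> i) * \<phi> x)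
        = (LINT x|lebesgue_on \<Omega>. (G x \<bullet> i) * \<phi> x) - (LINT x|lebesgue_on \<Omega>. (H x \<bullet> i) * \<phi> x)"
      using weak_gradient_integrable(2)[OF \<Omega> v(1) \<phi>, of i] weak_gradient_integrable(2)[OF \<Omega> v(2) \<phi>, of i]
      by (simp add: inner_diff_left left_diff_distrib)
    also have "\<dots> = 0"
    proof -
      have "(LINT x|lebesgue_on \<Omega>. v x * frechet_derivative \<phi> (at x) i) = - (LINT x|lebesgue_on \<Omega>. (G x \<bullet> i) * \<phi> x)"
        using v(1) \<phi> i unfolding has_weak_gradient_def by blast
      moreover have "(LINT x|lebesgue_on \<Omega>. v x * frechet_derivative \<phi> (at x) i) = - (LINT x|lebesgue_on \<Omega>. (H x \<bullet> i) * \<phi> x)"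
        using v(2) \<phi> i unfolding has_weak_gradient_def by blast
      ultimately show ?thesis by simp
    qed
    finally show "(LINT x|lebesgue_on \<Omega>. ((G x - H x) \<bullet> i) * \<phi> x) = 0" .
  qed
  then have "AE x in lebesgue_on \<Omega>. \<forall>i\<in>Basis. (G x - H x) \<bullet> i = 0"
    by (intro AE_finite_allI) auto
  then show ?thesis
    by eventually_elim (auto simp: inner_diff_left intro: euclidean_eqI)
qed

lemma wgrad_has_weak_gradient: "has_weak_gradient \<Omega> v G \<Longrightarrow> has_weak_gradient \<Omega> v (wgrad \<Omega> v)"
  unfolding wgrad_def by (rule someI[of "has_weak_gradient \<Omega> v"])

lemma wgrad_AE_eq: "open \<Omega> \<Longrightarrow> has_weak_gradient \<Omega> v G \<Longrightarrow> AE x in lebesgue_on \<Omega>. wgrad \<Omega> v x = G x"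
  using has_weak_gradient_unique wgrad_has_weak_gradient by blast

section \<open>Classical gradients of test functions as weak gradients\<close>

lemma locally_integrable_continuous:
  fixes f :: "'a::euclidean_space \<Rightarrow> 'b::euclidean_space"
  assumes "continuous_on UNIV f"
  shows "locally_integrable \<Omega> f"
  unfolding locally_integrable_def
proof (intro allI impI)
  fix K assume K: "compact K \<and> K \<subseteq> \<Omega>"
  then have "integrable lborel (\<lambda>x. indicator K x *\<^sub>R f x)"
    using assms by (intro borel_integrable_compact) (auto intro: continuous_on_subset)
  then have "integrable lebesgue (\<lambda>x. indicator K x *\<^sub>R f x)" by (simp add: integrable_completion)
  then show "integrable (lebesgue_on K) f"
    using K by (subst integrable_restrict_space) (auto intro: lmeasurable_compact fmeasurableD)
qed

text \<open>Integration by parts without boundary terms: the product of the two test functions is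
  compactly supported, so the integral of its directional derivative is 0, and the product rule
  splits it.\<close>

lemma test_function_has_weak_gradient:
  assumes \<Omega>: "open \<Omega>" and \<phi>: "\<phi> \<in> test_functions \<Omega>"
  shows "has_weak_gradient \<Omega> \<phi> (\<lambda>x. \<Sum>j\<in>Basis. frechet_derivative \<phi> (at x) j *\<^sub>R j)"
    (is "has_weak_gradient \<Omega> \<phi> ?G")
  unfolding has_weak_gradient_def
proof (intro conjI ballI)
  note cont = test_function_continuous[OF \<phi>]
  show loc: "locally_integrable \<Omega> \<phi>" by (rule locally_integrable_continuous[OF cont(1)])
  show "locally_integrable \<Omega> ?G"
    by (intro locally_integrable_continuous continuous_intros cont)
  fix \<psi> and i :: 'a assume \<psi>: "\<psi> \<in> test_functions \<Omega>" and i: "i \<in> Basis"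
  note cont' = test_function_continuous[OF \<psi>]
  obtain K where K: "compact K" "K \<subseteq> \<Omega>" "\<And>x. x \<notin> K \<Longrightarrow> \<psi> x = 0"
    "\<And>x h. x \<notin> K \<Longrightarrow> frechet_derivative \<psi> (at x) h = 0"
    using test_function_support[OF \<psi>] by metis
  have G: "?G x \<bullet> i = frechet_derivative \<phi> (at x) i" for x
    using i by (simp add: inner_sum_left inner_Basis if_distrib cong: if_cong)
  have int1: "integrable (lebesgue_on \<Omega>) (\<lambda>x. \<phi> x * frechet_derivative \<psi> (at x) i)"
    by (rule integrable_mult_compact_support[OF \<Omega> loc cont'(2) K(1,2,4)])
  have int2: "integrable (lebesgue_on \<Omega>) (\<lambda>x. frechet_derivative \<phi> (at x) i * \<psi> x)"
    by (rule integrable_mult_compact_support[OF \<Omega> locally_integrable_continuous[OF cont(2)] cont'(1) K(1,2,3)])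
  define P where "P x h = \<phi> x * frechet_derivative \<psi> (at x) h + frechet_derivative \<phi> (at x) h * \<psi> x" for x h
  have "(LINT x|lebesgue. P x i) = 0"
  proof (rule integral_directional_derivative_eq_0[of "\<lambda>x. \<phi> x * \<psi> x" P i K])
    show "((\<lambda>x. \<phi> x * \<psi> x) has_derivative P x) (at x)" for x
      using has_derivative_mult[OF cont(3) cont'(3)] unfolding P_def .
    show "continuous_on UNIV (\<lambda>x. P x i)"
      unfolding P_def by (intro continuous_intros cont cont')
  qed (auto simp: K P_def)
  also have "(LINT x|lebesgue. P x i) = (LINT x|lebesgue_on \<Omega>. P x i)"
  proof -
    have "(\<lambda>x. indicator \<Omega> x *\<^sub>R P x i) = (\<lambda>x. P x i)"
      by (rule ext, case_tac "x \<in> K") (use K in \<open>auto simp: P_def\<close>)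
    then show ?thesis using integral_restrict_space[of \<Omega> lebesgue "\<lambda>x. P x i"] \<Omega> by simp
  qed
  finally show "(LINT x|lebesgue_on \<Omega>. \<phi> x * frechet_derivative \<psi> (at x) i)
    = - (LINT x|lebesgue_on \<Omega>. (?G x \<bullet> i) * \<psi> x)"
    unfolding G P_def using int1 int2 by simp
qed

section \<open>The Sobolev spaces as vector spaces\<close>

lemma Lp_norm_powr:
  "0 < r \<Longrightarrow> Lp_norm r \<Omega> g powr r = (LINT x|lebesgue_on \<Omega>. norm (g x) powr r)"
  by (simp add: Lp_norm_def powr_powr)

lemma norm_linear_powr_le:
  fixes x y :: "'a::real_normed_vector"
  assumes "0 < r"
  shows "norm (a *\<^sub>R x + b *\<^sub>R y) powr r
    \<le> 2 powr r * (\<bar>a\<bar> powr r * norm x powr r + \<bar>b\<bar> powr r * norm y powr r)"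
  using norm_add_powr_le[OF assms, of "a *\<^sub>R x" "b *\<^sub>R y"] by (simp add: powr_mult)

lemma Lp_space_linear:
  fixes g h :: "'a::euclidean_space \<Rightarrow> 'b::euclidean_space"
  assumes "0 < r" "g \<in> Lp_space r \<Omega>" "h \<in> Lp_space r \<Omega>"
  shows "(\<lambda>x. a *\<^sub>R g x + b *\<^sub>R h x) \<in> Lp_space r \<Omega>"
proof -
  have [measurable]: "g \<in> borel_measurable (lebesgue_on \<Omega>)" "h \<in> borel_measurable (lebesgue_on \<Omega>)"
    and int: "integrable (lebesgue_on \<Omega>) (\<lambda>x. norm (g x) powr r)" "integrable (lebesgue_on \<Omega>) (\<lambda>x. norm (h x) powr r)"
    using assms by (auto simp: Lp_space_def)
  have "integrable (lebesgue_on \<Omega>) (\<lambda>x. norm (a *\<^sub>R g x + b *\<^sub>R h x) powr r)"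
  proof (rule Bochner_Integration.integrable_bound)
    show "integrable (lebesgue_on \<Omega>)
        (\<lambda>x. 2 powr r * (\<bar>a\<bar> powr r * norm (g x) powr r + \<bar>b\<bar> powr r * norm (h x) powr r))"
      using int by simp
    show "AE x in lebesgue_on \<Omega>. norm (norm (a *\<^sub>R g x + b *\<^sub>R h x) powr r)
        \<le> norm (2 powr r * (\<bar>a\<bar> powr r * norm (g x) powr r + \<bar>b\<bar> powr r * norm (h x) powr r))"
      by (rule AE_I2) (use norm_linear_powr_le[OF assms(1)] in simp)
  qed measurable
  then show ?thesis by (simp add: Lp_space_def)
qed

text \<open>A triangle inequality with the crude factor 2 is enough, since it only serves to show
  that norms tend to 0. It follows from the pointwise power bound and subadditivity of the power
  \<open>1/r\<close>.\<close>

lemma Lp_norm_linear_le: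
  fixes g h :: "'a::euclidean_space \<Rightarrow> 'b::euclidean_space"
  assumes r: "1 \<le> r" and g: "g \<in> Lp_space r \<Omega>" and h: "h \<in> Lp_space r \<Omega>"
  shows "Lp_norm r \<Omega> (\<lambda>x. a *\<^sub>R g x + b *\<^sub>R h x) \<le> 2 * (\<bar>a\<bar> * Lp_norm r \<Omega> g + \<bar>b\<bar> * Lp_norm r \<Omega> h)"
proof -
  define I where "I = (LINT x|lebesgue_on \<Omega>. norm (g x) powr r)"
  define J where "J = (LINT x|lebesgue_on \<Omega>. norm (h x) powr r)"
  have r0: "0 < r" using r by simp
  have int: "integrable (lebesgue_on \<Omega>) (\<lambda>x. norm (g x) powr r)" "integrable (lebesgue_on \<Omega>) (\<lambda>x. norm (h x) powr r)"
    "integrable (lebesgue_on \<Omega>) (\<lambda>x. norm (a *\<^sub>R g x + b *\<^sub>R h x) powr r)"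
    using g h Lp_space_linear[OF r0 g h] by (auto simp: Lp_space_def)
  have I: "0 \<le> I" "0 \<le> J" by (auto simp: I_def J_def)
  have "(LINT x|lebesgue_on \<Omega>. norm (a *\<^sub>R g x + b *\<^sub>R h x) powr r)
      \<le> (LINT x|lebesgue_on \<Omega>. 2 powr r * (\<bar>a\<bar> powr r * norm (g x) powr r + \<bar>b\<bar> powr r * norm (h x) powr r))"
    using int by (intro integral_mono norm_linear_powr_le[OF r0]) auto
  also have "\<dots> = 2 powr r * (\<bar>a\<bar> powr r * I + \<bar>b\<bar> powr r * J)"
    using int by (simp add: I_def J_def)
  finally have "Lp_norm r \<Omega> (\<lambda>x. a *\<^sub>R g x + b *\<^sub>R h x) \<le> (2 powr r * (\<bar>a\<bar> powr r * I + \<bar>b\<bar> powr r * J)) powr (1/r)"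
    unfolding Lp_norm_def using r by (intro powr_mono2) auto
  also have "\<dots> = 2 * (\<bar>a\<bar> powr r * I + \<bar>b\<bar> powr r * J) powr (1/r)"
    using r by (simp add: powr_mult powr_powr)
  also have "(\<bar>a\<bar> powr r * I + \<bar>b\<bar> powr r * J) powr (1/r) \<le> (\<bar>a\<bar> powr r * I) powr (1/r) + (\<bar>b\<bar> powr r * J) powr (1/r)"
    using I r by (intro powr_add_le_add_powr) auto
  also have "\<dots> = \<bar>a\<bar> * Lp_norm r \<Omega> g + \<bar>b\<bar> * Lp_norm r \<Omega> h"
    using I r by (simp add: powr_mult powr_powr Lp_norm_def I_def J_def)
  finally show ?thesis by simp
qed

text \<open>Extension by zero moves the claim to Lebesgue measure on the whole space, where
  completeness makes null sets harmless.\<close>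

lemma borel_measurable_lebesgue_on_AE:
  fixes g h :: "'a::euclidean_space \<Rightarrow> 'b::euclidean_space"
  assumes \<Omega>: "\<Omega> \<in> sets lebesgue" and g: "g \<in> borel_measurable (lebesgue_on \<Omega>)"
    and eq: "AE x in lebesgue_on \<Omega>. g x = h x"
  shows "h \<in> borel_measurable (lebesgue_on \<Omega>)"
proof -
  have "AE x in lebesgue. x \<in> \<Omega> \<longrightarrow> g x = h x"
    using eq \<Omega> by (subst (asm) AE_restrict_space_iff) auto
  then have "AE x in lebesgue. (if x \<in> \<Omega> then g x else 0) = (if x \<in> \<Omega> then h x else 0)"
    by eventually_elim auto
  from borel_measurable_AE[OF borel_measurable_if_I[OF g \<Omega>] this] show ?thesis
    by (rule borel_measurable_if_D)
qed

lemma Lp_space_AE: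
  fixes g h :: "'a::euclidean_space \<Rightarrow> 'b::euclidean_space"
  assumes \<Omega>: "\<Omega> \<in> sets lebesgue" and g: "g \<in> Lp_space r \<Omega>"
    and eq: "AE x in lebesgue_on \<Omega>. g x = h x"
  shows "h \<in> Lp_space r \<Omega>" and "Lp_norm r \<Omega> h = Lp_norm r \<Omega> g"
proof -
  have gm[measurable]: "g \<in> borel_measurable (lebesgue_on \<Omega>)" using g by (simp add: Lp_space_def)
  have hm[measurable]: "h \<in> borel_measurable (lebesgue_on \<Omega>)"
    by (rule borel_measurable_lebesgue_on_AE[OF \<Omega> gm eq])
  have eq': "AE x in lebesgue_on \<Omega>. norm (h x) powr r = norm (g x) powr r"
    using eq by eventually_elim simp
  have "integrable (lebesgue_on \<Omega>) (\<lambda>x. norm (h x) powr r) \<longleftrightarrow> integrable (lebesgue_on \<Omega>) (\<lambda>x. norm (g x) powr r)"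
    by (rule integrable_cong_AE[OF _ _ eq']) measurable
  then show "h \<in> Lp_space r \<Omega>" using g hm by (simp add: Lp_space_def)
  have "(LINT x|lebesgue_on \<Omega>. norm (h x) powr r) = (LINT x|lebesgue_on \<Omega>. norm (g x) powr r)"
    by (rule integral_cong_AE[OF _ _ eq']) measurable
  then show "Lp_norm r \<Omega> h = Lp_norm r \<Omega> g" by (simp add: Lp_norm_def)
qed

lemma sobolevD:
  assumes "v \<in> sobolev r \<Omega>"
  shows "v \<in> Lp_space r \<Omega>" "has_weak_gradient \<Omega> v (wgrad \<Omega> v)" "wgrad \<Omega> v \<in> Lp_space r \<Omega>"
  using assms wgrad_has_weak_gradient by (auto simp: sobolev_def)

text \<open>Membership is defined through the chosen representative \<open>wgrad\<close>; by
  uniqueness any representative of the weak gradient can witness it.\<close>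

lemma sobolevI:
  assumes "open \<Omega>" "v \<in> Lp_space r \<Omega>" "has_weak_gradient \<Omega> v G" "G \<in> Lp_space r \<Omega>"
  shows "v \<in> sobolev r \<Omega>"
proof -
  have sets: "\<Omega> \<in> sets lebesgue" using assms(1) by auto
  have "AE x in lebesgue_on \<Omega>. G x = wgrad \<Omega> v x"
    using wgrad_AE_eq[OF assms(1,3)] by eventually_elim simp
  then have "wgrad \<Omega> v \<in> Lp_space r \<Omega>" by (rule Lp_space_AE(1)[OF sets assms(4)])
  then show ?thesis using assms(2,3) unfolding sobolev_def by blast
qed

lemma wgrad_linear_AE:
  assumes "open \<Omega>" "v \<in> sobolev r \<Omega>" "w \<in> sobolev r \<Omega>"
  shows "AE x in lebesgue_on \<Omega>. wgrad \<Omega> (\<lambda>x. a * v x + b * w x) x = a *\<^sub>R wgrad \<Omega> v x + b *\<^sub>R wgrad \<Omega> w x"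
  using assms by (intro wgrad_AE_eq has_weak_gradient_linear sobolevD)

lemma sobolev_linear:
  assumes \<Omega>: "open \<Omega>" and r: "0 < r" and v: "v \<in> sobolev r \<Omega>" and w: "w \<in> sobolev r \<Omega>"
  shows "(\<lambda>x. a * v x + b * w x) \<in> sobolev r \<Omega>"
proof (rule sobolevI[OF \<Omega>])
  show "(\<lambda>x. a * v x + b * w x) \<in> Lp_space r \<Omega>"
    using Lp_space_linear[OF r sobolevD(1)[OF v] sobolevD(1)[OF w], of a b] by simp
  show "has_weak_gradient \<Omega> (\<lambda>x. a * v x + b * w x) (\<lambda>x. a *\<^sub>R wgrad \<Omega> v x + b *\<^sub>R wgrad \<Omega> w x)"
    by (intro has_weak_gradient_linear \<Omega> sobolevD(2)[OF v] sobolevD(2)[OF w])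
  show "(\<lambda>x. a *\<^sub>R wgrad \<Omega> v x + b *\<^sub>R wgrad \<Omega> w x) \<in> Lp_space r \<Omega>"
    by (intro Lp_space_linear r sobolevD(3)[OF v] sobolevD(3)[OF w])
qed

lemma sobolev_norm_linear_le:
  assumes \<Omega>: "open \<Omega>" and r: "1 \<le> r" and v: "v \<in> sobolev r \<Omega>" and w: "w \<in> sobolev r \<Omega>"
  shows "sobolev_norm r \<Omega> (\<lambda>x. a * v x + b * w x)
    \<le> 2 * (\<bar>a\<bar> * sobolev_norm r \<Omega> v + \<bar>b\<bar> * sobolev_norm r \<Omega> w)"
proof -
  have r0: "0 < r" using r by simp
  have sets: "\<Omega> \<in> sets lebesgue" using \<Omega> by auto
  have "AE x in lebesgue_on \<Omega>. a *\<^sub>R wgrad \<Omega> v x + b *\<^sub>R wgrad \<Omega> w x = wgrad \<Omega> (\<lambda>x. a * v x + b * w x) x"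
    using wgrad_linear_AE[OF \<Omega> v w, of a b] by eventually_elim simp
  then have "Lp_norm r \<Omega> (wgrad \<Omega> (\<lambda>x. a * v x + b * w x))
      = Lp_norm r \<Omega> (\<lambda>x. a *\<^sub>R wgrad \<Omega> v x + b *\<^sub>R wgrad \<Omega> w x)"
    by (rule Lp_space_AE(2)[OF sets Lp_space_linear[OF r0 sobolevD(3)[OF v] sobolevD(3)[OF w]]])
  then show ?thesis
    using Lp_norm_linear_le[OF r sobolevD(1)[OF v] sobolevD(1)[OF w], of a b]
      Lp_norm_linear_le[OF r sobolevD(3)[OF v] sobolevD(3)[OF w], of a b]
    unfolding sobolev_norm_def by (simp add: algebra_simps)
qed

section \<open>Test functions in the Sobolev spaces, and linearity of the space with zero boundary
  values\<close>

lemma continuous_compact_support_Lp: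
  fixes f :: "'a::euclidean_space \<Rightarrow> 'b::euclidean_space"
  assumes \<Omega>: "open \<Omega>" and r: "0 < r" and f: "continuous_on UNIV f"
    and K: "compact K" "K \<subseteq> \<Omega>" "\<And>x. x \<notin> K \<Longrightarrow> f x = 0"
  shows "f \<in> Lp_space r \<Omega>"
proof -
  have cont: "continuous_on UNIV (\<lambda>x. norm (f x) powr r)"
    using f r by (intro continuous_on_powr' continuous_intros) auto
  have "integrable (lebesgue_on \<Omega>) (\<lambda>x. 1 * norm (f x) powr r)"
    by (rule integrable_mult_compact_support[OF \<Omega> locally_integrable_continuous cont K(1,2)])
       (use K(3) in auto)
  moreover have "f \<in> borel_measurable (lebesgue_on \<Omega>)"
    using f by (intro measurable_restrict_space1 measurable_completion) (simp add: borel_measurable_continuous_onI)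
  ultimately show ?thesis by (simp add: Lp_space_def)
qed

text \<open>Ensures that the difference of a Sobolev function and its smooth approximant is again a
  Sobolev function, as the norm inequality requires.\<close>

lemma test_function_sobolev:
  assumes \<Omega>: "open \<Omega>" and r: "0 < r" and \<phi>: "\<phi> \<in> test_functions \<Omega>"
  shows "\<phi> \<in> sobolev r \<Omega>"
proof -
  obtain K where K: "compact K" "K \<subseteq> \<Omega>" "\<And>x. x \<notin> K \<Longrightarrow> \<phi> x = 0"
    "\<And>x h. x \<notin> K \<Longrightarrow> frechet_derivative \<phi> (at x) h = 0"
    using test_function_support[OF \<phi>] by metis
  note cont = test_function_continuous[OF \<phi>]
  show ?thesis
  proof (rule sobolevI[OF \<Omega> _ test_function_has_weak_gradient[OF \<Omega> \<phi>]])
    show "\<phi> \<in> Lp_space r \<Omega>"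
      by (rule continuous_compact_support_Lp[OF \<Omega> r cont(1) K(1,2,3)])
    show "(\<lambda>x. \<Sum>j\<in>Basis. frechet_derivative \<phi> (at x) j *\<^sub>R j) \<in> Lp_space r \<Omega>"
      by (rule continuous_compact_support_Lp[OF \<Omega> r _ K(1,2)])
         (auto intro!: continuous_intros cont simp: K(4))
  qed
qed

text \<open>Approximating sequences combine linearly, and the quasi-triangle inequality carries the
  convergence over. In particular the reflection of one such function in another is admissible in
  the minimization.\<close>

lemma sobolev0_linear:
  assumes \<Omega>: "open \<Omega>" and r: "1 \<le> r" and v: "v \<in> sobolev0 r \<Omega>" and w: "w \<in> sobolev0 r \<Omega>"
  shows "(\<lambda>x. a * v x + b * w x) \<in> sobolev0 r \<Omega>"
proof -
  have r0: "0 < r" using r by simp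
  obtain \<phi> \<psi> where \<phi>: "\<And>n. \<phi> n \<in> test_functions \<Omega>" "(\<lambda>n. sobolev_norm r \<Omega> (\<lambda>x. v x - \<phi> n x)) \<longlonglongrightarrow> 0"
    and \<psi>: "\<And>n. \<psi> n \<in> test_functions \<Omega>" "(\<lambda>n. sobolev_norm r \<Omega> (\<lambda>x. w x - \<psi> n x)) \<longlonglongrightarrow> 0"
    using v w unfolding sobolev0_def by blast
  have vw: "v \<in> sobolev r \<Omega>" "w \<in> sobolev r \<Omega>" using v w by (auto simp: sobolev0_def)
  have diff: "(\<lambda>x. z x - \<eta> x) \<in> sobolev r \<Omega>" if "z \<in> sobolev r \<Omega>" "\<eta> \<in> test_functions \<Omega>" for z \<eta>
    using sobolev_linear[OF \<Omega> r0 that(1) test_function_sobolev[OF \<Omega> r0 that(2)], of 1 "-1"] by simp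
  have bound: "sobolev_norm r \<Omega> (\<lambda>x. (a * v x + b * w x) - (a * \<phi> n x + b * \<psi> n x))
      \<le> 2 * (\<bar>a\<bar> * sobolev_norm r \<Omega> (\<lambda>x. v x - \<phi> n x) + \<bar>b\<bar> * sobolev_norm r \<Omega> (\<lambda>x. w x - \<psi> n x))" for n
    using sobolev_norm_linear_le[OF \<Omega> r diff[OF vw(1) \<phi>(1)[of n]] diff[OF vw(2) \<psi>(1)[of n]], of a b]
    by (simp add: algebra_simps)
  have "(\<lambda>n. 2 * (\<bar>a\<bar> * sobolev_norm r \<Omega> (\<lambda>x. v x - \<phi> n x) + \<bar>b\<bar> * sobolev_norm r \<Omega> (\<lambda>x. w x - \<psi> n x)))
      \<longlonglongrightarrow> 2 * (\<bar>a\<bar> * 0 + \<bar>b\<bar> * 0)"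
    by (intro tendsto_intros \<phi> \<psi>)
  then have lim: "(\<lambda>n. 2 * (\<bar>a\<bar> * sobolev_norm r \<Omega> (\<lambda>x. v x - \<phi> n x) + \<bar>b\<bar> * sobolev_norm r \<Omega> (\<lambda>x. w x - \<psi> n x)))
      \<longlonglongrightarrow> 0" by simp
  have "(\<lambda>n. sobolev_norm r \<Omega> (\<lambda>x. (a * v x + b * w x) - (a * \<phi> n x + b * \<psi> n x))) \<longlonglongrightarrow> 0"
    by (rule tendsto_sandwich[OF _ _ tendsto_const lim])
       (use bound in \<open>auto simp: sobolev_norm_def Lp_norm_def\<close>)
  moreover have "(\<lambda>x. a * \<phi> n x + b * \<psi> n x) \<in> test_functions \<Omega>" for n
    by (intro test_functions_linear \<phi> \<psi>)
  ultimately show ?thesis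
    unfolding sobolev0_def using sobolev_linear[OF \<Omega> r0 vw]
    by (auto intro!: exI[of _ "\<lambda>n x. a * \<phi> n x + b * \<psi> n x"])
qed

lemma sobolev0_dual_linear:
  assumes \<Omega>: "open \<Omega>" and r: "1 \<le> r" and f: "f \<in> sobolev0_dual r \<Omega>"
    and v: "v \<in> sobolev0 r \<Omega>" and w: "w \<in> sobolev0 r \<Omega>"
  shows "f (\<lambda>x. a * v x + b * w x) = a * f v + b * f w"
proof -
  have "(\<lambda>x. a * v x) \<in> sobolev0 r \<Omega>" "(\<lambda>x. b * w x) \<in> sobolev0 r \<Omega>"
    using sobolev0_linear[OF \<Omega> r v v, of a 0] sobolev0_linear[OF \<Omega> r w w, of b 0] by simp_all
  then show ?thesis using f v w by (simp add: sobolev0_dual_def)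
qed

text \<open>Testing minimality of \<open>u\<close> with the reflection \<open>2u - w\<close> of the competitor bounds the
  linear term.\<close>

lemma energy_gap_le:
  assumes \<Omega>: "open \<Omega>" and p: "1 < p" "p \<le> 2" and f: "f \<in> sobolev0_dual p \<Omega>"
    and u: "is_minimizer p \<Omega> (energy p \<Omega> f) u" and w: "w \<in> sobolev0 p \<Omega>"
  shows "energy p \<Omega> f w - energy p \<Omega> f u
    \<le> 2 / p * (LINT x|lebesgue_on \<Omega>. norm (wgrad \<Omega> (\<lambda>x. u x - w x) x) powr p)"
proof -
  have p': "1 \<le> p" "0 < p" using p by auto
  have sets: "\<Omega> \<in> sets lebesgue" using \<Omega> by auto
  have u0: "u \<in> sobolev0 p \<Omega>" using u by (simp add: is_minimizer_def is_arg_min_def)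
  have uw: "u \<in> sobolev p \<Omega>" "w \<in> sobolev p \<Omega>" using u0 w by (auto simp: sobolev0_def)
  \<comment> \<open>With \<open>d = u - w\<close> one has \<open>z = u + d\<close> and
    \<open>w = u - d\<close>, the two arguments of the second difference.\<close>
  define z where "z x = 2 * u x + (-1) * w x" for x
  define d where "d x = u x - w x" for x
  have z0: "z \<in> sobolev0 p \<Omega>"
    using sobolev0_linear[OF \<Omega> p'(1) u0 w, of 2 "-1"] by (simp add: z_def[abs_def])
  have d: "d \<in> sobolev p \<Omega>"
    using sobolev_linear[OF \<Omega> p'(2) uw, of 1 "-1"] by (simp add: d_def[abs_def])
  have fz: "f z = 2 * f u - f w"
    using sobolev0_dual_linear[OF \<Omega> p'(1) f u0 w, of 2 "-1"] by (simp add: z_def[abs_def])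
  define g D where "g = wgrad \<Omega> u" and "D = wgrad \<Omega> d"
  have gz: "AE x in lebesgue_on \<Omega>. 1 *\<^sub>R g x + 1 *\<^sub>R D x = wgrad \<Omega> z x"
    using wgrad_linear_AE[OF \<Omega> uw(1) d, of 1 1]
    by (simp add: g_def D_def d_def[abs_def] z_def[abs_def] eq_commute)
  have gw: "AE x in lebesgue_on \<Omega>. 1 *\<^sub>R g x + (-1) *\<^sub>R D x = wgrad \<Omega> w x"
    using wgrad_linear_AE[OF \<Omega> uw(1) d, of 1 "-1"]
    by (simp add: g_def D_def d_def[abs_def] eq_commute)
  have gD: "g \<in> Lp_space p \<Omega>" "D \<in> Lp_space p \<Omega>"
    using uw d sobolevD by (auto simp: g_def D_def)
  note sum = Lp_space_linear[OF p'(2) gD, of 1 1] and dif = Lp_space_linear[OF p'(2) gD, of 1 "-1"]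
  have Iz: "(LINT x|lebesgue_on \<Omega>. norm (wgrad \<Omega> z x) powr p) = (LINT x|lebesgue_on \<Omega>. norm (g x + D x) powr p)"
    using arg_cong[OF Lp_space_AE(2)[OF sets sum gz], of "\<lambda>t. t powr p"] p' by (simp add: Lp_norm_powr)
  have Iw: "(LINT x|lebesgue_on \<Omega>. norm (wgrad \<Omega> w x) powr p) = (LINT x|lebesgue_on \<Omega>. norm (g x - D x) powr p)"
    using arg_cong[OF Lp_space_AE(2)[OF sets dif gw], of "\<lambda>t. t powr p"] p' by (simp add: Lp_norm_powr)
  have int: "integrable (lebesgue_on \<Omega>) (\<lambda>x. norm (g x + D x) powr p)"
    "integrable (lebesgue_on \<Omega>) (\<lambda>x. norm (g x - D x) powr p)"
    "integrable (lebesgue_on \<Omega>) (\<lambda>x. norm (g x) powr p)"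
    "integrable (lebesgue_on \<Omega>) (\<lambda>x. norm (D x) powr p)"
    using sum dif gD by (auto simp: Lp_space_def)
  have "(LINT x|lebesgue_on \<Omega>. norm (g x + D x) powr p + norm (g x - D x) powr p)
      \<le> (LINT x|lebesgue_on \<Omega>. 2 * norm (g x) powr p + 2 * norm (D x) powr p)"
    using int p by (intro integral_mono norm_powr_second_difference) auto
  then have le: "(LINT x|lebesgue_on \<Omega>. norm (g x + D x) powr p) + (LINT x|lebesgue_on \<Omega>. norm (g x - D x) powr p)
      \<le> 2 * (LINT x|lebesgue_on \<Omega>. norm (g x) powr p) + 2 * (LINT x|lebesgue_on \<Omega>. norm (D x) powr p)"
    using int by simp
  have min: "energy p \<Omega> f u \<le> energy p \<Omega> f z"
    using u z0 by (auto simp: is_minimizer_def is_arg_min_def not_less)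
  \<comment> \<open>Since \<open>f w + f z = 2 * f u\<close>, adding the minimality inequality for
    \<open>z\<close> cancels the linear terms and leaves a second difference of gradient
    integrals.\<close>
  have "energy p \<Omega> f w - energy p \<Omega> f u
      \<le> 1 / p * ((LINT x|lebesgue_on \<Omega>. norm (g x + D x) powr p) + (LINT x|lebesgue_on \<Omega>. norm (g x - D x) powr p)
          - 2 * (LINT x|lebesgue_on \<Omega>. norm (g x) powr p))"
    using min unfolding energy_def Iz Iw fz g_def[symmetric] by (simp add: algebra_simps)
  also have "\<dots> \<le> 1 / p * (2 * (LINT x|lebesgue_on \<Omega>. norm (D x) powr p))"
    using le p' by (intro mult_left_mono) auto
  finally show ?thesis by (simp add: D_def d_def[abs_def])
qed

section \<open>The maximal function\<close>

lemma emeasure_lborel_ball: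
  fixes x :: "'a::euclidean_space"
  assumes "0 \<le> r"
  shows "emeasure lborel (ball x r) = ennreal (r ^ DIM('a) * measure lborel (ball (0::'a) 1))"
proof -
  have "emeasure lborel (ball x r) = ennreal (measure lborel (ball x r))"
    using emeasure_eq_ennreal_measure[of lborel "ball x r"] emeasure_lborel_ball_finite[of x r] by auto
  also have "measure lborel (ball x r) = r ^ DIM('a) * measure lborel (ball (0::'a) 1)"
    by (rule content_ball_conv_unit_ball) (use assms in auto)
  finally show ?thesis .
qed

text \<open>A supremum exceeds \<open>s\<close> iff one of its members does. Ball volumes are
  positive and finite, so the denominator can be cleared even when the integral is infinite.\<close>

lemma maximal_gt_iff:
  fixes g :: "'a::euclidean_space \<Rightarrow> 'b::real_normed_vector"
  assumes "0 \<le> s"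
  shows "maximal g x > ennreal s \<longleftrightarrow>
    (\<exists>r>0. ennreal (s * (r ^ DIM('a) * measure lborel (ball (0::'a) 1))) < (\<integral>\<^sup>+y\<in>ball x r. ennreal (norm (g y)) \<partial>lebesgue))"
proof -
  have "ennreal s < I / emeasure lebesgue (ball x r) \<longleftrightarrow>
        ennreal (s * (r ^ DIM('a) * measure lborel (ball (0::'a) 1))) < I" if "0 < r" for r I
  proof -
    define B where "B = r ^ DIM('a) * measure lborel (ball (0::'a) 1)"
    have B: "0 < B" using that by (simp add: B_def)
    have "ennreal s < I / ennreal B \<longleftrightarrow> ennreal s * ennreal B < I"
    proof (cases I)
      case (real i)
      then show ?thesis
        using B assms by (simp add: divide_ennreal ennreal_mult[symmetric] ennreal_less_iff pos_less_divide_eq)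
    next
      case top
      then show ?thesis using B by (simp add: ennreal_top_divide ennreal_mult_less_top)
    qed
    then show ?thesis
      using B assms that by (simp add: emeasure_lborel_ball B_def[symmetric] ennreal_mult[symmetric])
  qed
  then show ?thesis
    unfolding maximal_def less_SUP_iff by auto
qed

text \<open>Lower semicontinuity: the strict inequality for a ball of radius \<open>r\<close>
  survives a slightly larger \<open>\<sigma>\<close>, and a ball of radius \<open>\<sigma>\<close>
  about any point closer than \<open>\<sigma> - r\<close> contains the original one. This also makes
  the bad set measurable.\<close>

lemma open_maximal_gt:
  fixes g :: "'a::euclidean_space \<Rightarrow> 'b::real_normed_vector"
  assumes s: "0 \<le> s"
  shows "open {x. maximal g x > ennreal s}"
  unfolding open_contains_ball
proof
  fix x assume "x \<in> {x. maximal g x > ennreal s}"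
  then obtain r where r: "0 < r"
    "ennreal (s * (r ^ DIM('a) * measure lborel (ball (0::'a) 1))) < (\<integral>\<^sup>+y\<in>ball x r. ennreal (norm (g y)) \<partial>lebesgue)"
    (is "?f r < ?I") using maximal_gt_iff[OF s] by auto
  have "((\<lambda>\<rho>. s * (\<rho> ^ DIM('a) * measure lborel (ball (0::'a) 1))) \<longlongrightarrow> s * (r ^ DIM('a) * measure lborel (ball (0::'a) 1))) (at_right r)"
    by (intro tendsto_intros)
  then have "(?f \<longlongrightarrow> ?f r) (at_right r)" by (rule tendsto_ennrealI)
  then have "eventually (\<lambda>\<rho>. ?f \<rho> < ?I) (at_right r)" using r by (intro order_tendstoD)
  then obtain \<rho> where \<rho>: "r < \<rho>" "\<And>y. r < y \<Longrightarrow> y < \<rho> \<Longrightarrow> ?f y < ?I"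
    unfolding eventually_at_right_field by auto
  define \<sigma> where "\<sigma> = (r + \<rho>) / 2"
  have \<sigma>: "r < \<sigma>" "?f \<sigma> < ?I" using \<rho> by (auto simp: \<sigma>_def)
  have "maximal g y > ennreal s" if "y \<in> ball x (\<sigma> - r)" for y
  proof -
    have "ball x r \<subseteq> ball y \<sigma>"
    proof
      fix z assume "z \<in> ball x r"
      then show "z \<in> ball y \<sigma>" using that dist_triangle[of y z x] by (simp add: dist_commute)
    qed
    then have "?I \<le> (\<integral>\<^sup>+z\<in>ball y \<sigma>. ennreal (norm (g z)) \<partial>lebesgue)"
      by (intro nn_integral_mono mult_left_mono) (auto simp: indicator_def)
    then show ?thesis
      using \<sigma> r maximal_gt_iff[OF s, of g y] by (auto intro!: exI[of _ \<sigma>])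
  qed
  then show "\<exists>e>0. ball x e \<subseteq> {x. maximal g x > ennreal s}"
    using \<sigma> by (intro exI[of _ "\<sigma> - r"]) auto
qed

text \<open>Each point of the superlevel set is the centre of a ball on which the average exceeds
  \<open>s\<close>. Vitali's lemma selects countably many disjoint ones whose fivefold enlargements
  still cover, whence the factor \<open>5 ^ DIM('a)\<close>.\<close>

lemma maximal_weak_type:
  fixes g :: "'a::euclidean_space \<Rightarrow> 'b::{real_normed_vector,second_countable_topology}"
  assumes g[measurable]: "g \<in> borel_measurable lebesgue" and s: "0 < s"
  shows "ennreal s * emeasure lebesgue {x. maximal g x > ennreal s}
    \<le> ennreal (5 ^ DIM('a)) * (\<integral>\<^sup>+y. ennreal (norm (g y)) \<partial>lebesgue)"
proof (cases "(\<integral>\<^sup>+y. ennreal (norm (g y)) \<partial>lebesgue)")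
  case top
  then show ?thesis by (simp add: ennreal_mult_top)
next
  case (real I)
  define S where "S = {x. maximal g x > ennreal s}"
  define \<omega> where "\<omega> = measure lborel (ball (0::'a) 1)"
  have \<omega>: "0 < \<omega>" by (simp add: \<omega>_def)
  have "\<forall>x\<in>S. \<exists>r>0. ennreal (s * (r ^ DIM('a) * \<omega>)) < (\<integral>\<^sup>+y\<in>ball x r. ennreal (norm (g y)) \<partial>lebesgue)"
    using maximal_gt_iff[of s g] s by (auto simp: S_def \<omega>_def)
  then obtain r where r: "\<And>x. x \<in> S \<Longrightarrow> 0 < r x"
    "\<And>x. x \<in> S \<Longrightarrow> ennreal (s * (r x ^ DIM('a) * \<omega>)) < (\<integral>\<^sup>+y\<in>ball x (r x). ennreal (norm (g y)) \<partial>lebesgue)"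
    by metis
  \<comment> \<open>Vitali's lemma asks for bounded radii. If \<open>r x > 1\<close>, then
    \<open>r x\<close> is at most its power with exponent \<open>DIM('a)\<close>, which is less than
    \<open>I / (s * \<omega>)\<close> because the integral over any ball is at most
    \<open>I\<close>.\<close>
  define R where "R = max 1 (I / (s * \<omega>))"
  have R: "r x \<le> R" if x: "x \<in> S" for x
  proof (cases "r x \<le> 1")
    case False
    have "ennreal (s * (r x ^ DIM('a) * \<omega>)) < ennreal I"
      using r(2)[OF x] unfolding real(2)[symmetric]
      by (rule less_le_trans) (auto intro!: nn_integral_mono simp: indicator_def)
    then have "s * (r x ^ DIM('a) * \<omega>) < I" using real(1) s \<omega> r(1)[OF x] by (simp add: ennreal_less_iff)
    then have "r x ^ DIM('a) < I / (s * \<omega>)" using s \<omega> by (simp add: field_simps)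
    moreover have "r x ^ 1 \<le> r x ^ DIM('a)"
      using False by (intro power_increasing) (auto simp: Suc_le_eq)
    ultimately show ?thesis by (simp add: R_def)
  qed (simp add: R_def)
  have "S \<subseteq> (\<Union>x\<in>S. ball x (r x))" using r by auto
  moreover have "\<And>x. x \<in> S \<Longrightarrow> 0 < r x \<and> r x \<le> R" using r R by blast
  ultimately obtain C where C: "countable C" "C \<subseteq> S"
    "pairwise (\<lambda>i j. disjnt (ball i (r i)) (ball j (r j))) C" "S \<subseteq> (\<Union>i\<in>C. ball i (5 * r i))"
    by (rule Vitali_covering_lemma_balls) (assumption | rule that)+
  define N where "N = to_nat_on C ` C"
  define c where "c = from_nat_into C"
  have cC: "c n \<in> C" if "n \<in> N" for n
    using that C by (auto simp: N_def c_def)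
  define E where "E n = (if n \<in> N then ball (c n) (r (c n)) else {})" for n
  define F where "F n = (if n \<in> N then ball (c n) (5 * r (c n)) else {})" for n
  have [measurable]: "E n \<in> sets lebesgue" "F n \<in> sets lebesgue" for n
    by (auto simp: E_def F_def)
  have SF: "S \<subseteq> (\<Union>n. F n)"
  proof
    fix x assume "x \<in> S"
    then obtain i where i: "i \<in> C" "x \<in> ball i (5 * r i)" using C by auto
    then have "x \<in> F (to_nat_on C i)" using C by (auto simp: F_def N_def c_def)
    then show "x \<in> (\<Union>n. F n)" by blast
  qed
  have disj: "disjoint_family E"
  unfolding disjoint_family_on_def
  proof (intro ballI impI)
    fix m n :: nat assume mn: "m \<noteq> n"
    show "E m \<inter> E n = {}"
    proof (cases "m \<in> N \<and> n \<in> N")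
      case True
      then have "c m \<noteq> c n" using mn C by (auto simp: N_def c_def)
      then have "disjnt (E m) (E n)"
        using True C(3) cC by (auto simp: pairwise_def E_def)
      then show ?thesis by (simp add: disjnt_def)
    qed (auto simp: E_def)
  qed
  \<comment> \<open>Integrals of the norm of \<open>g\<close> become values of a measure, so that
    disjointness of the \<open>E n\<close> can be used as countable additivity.\<close>
  define \<mu> where "\<mu> = density lebesgue (\<lambda>y. ennreal (norm (g y)))"
  have \<mu>: "emeasure \<mu> A = (\<integral>\<^sup>+y\<in>A. ennreal (norm (g y)) \<partial>lebesgue)" if "A \<in> sets lebesgue" for A
    unfolding \<mu>_def using that by (subst emeasure_density) auto
  have EF: "ennreal s * emeasure lebesgue (F n) \<le> ennreal (5 ^ DIM('a)) * emeasure \<mu> (E n)" for n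
  proof (cases "n \<in> N")
    case True
    define x where "x = c n"
    have x: "x \<in> S" using cC[OF True] C by (auto simp: x_def)
    have "ennreal s * emeasure lebesgue (F n) = ennreal s * ennreal ((5 * r x) ^ DIM('a) * \<omega>)"
      using True r(1)[OF x] by (simp add: F_def emeasure_lborel_ball \<omega>_def x_def)
    also have "\<dots> = ennreal (5 ^ DIM('a)) * ennreal (s * (r x ^ DIM('a) * \<omega>))"
      using s \<omega> r(1)[OF x] by (simp add: ennreal_mult[symmetric] power_mult_distrib mult_ac)
    also have "\<dots> \<le> ennreal (5 ^ DIM('a)) * emeasure \<mu> (E n)"
      using r(2)[OF x] True by (intro mult_left_mono) (auto simp: \<mu> E_def x_def)
    finally show ?thesis .
  qed (simp add: F_def)
  have "ennreal s * emeasure lebesgue S \<le> ennreal s * emeasure lebesgue (\<Union>n. F n)"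
    by (intro mult_left_mono emeasure_mono SF) auto
  also have "\<dots> \<le> ennreal s * (\<Sum>n. emeasure lebesgue (F n))"
    by (intro mult_left_mono emeasure_subadditive_countably) auto
  also have "\<dots> = (\<Sum>n. ennreal s * emeasure lebesgue (F n))" by simp
  also have "\<dots> \<le> (\<Sum>n. ennreal (5 ^ DIM('a)) * emeasure \<mu> (E n))"
    by (intro suminf_le EF) auto
  also have "\<dots> = ennreal (5 ^ DIM('a)) * (\<Sum>n. emeasure \<mu> (E n))" by simp
  also have "(\<Sum>n. emeasure \<mu> (E n)) = emeasure \<mu> (\<Union>n. E n)"
    by (rule suminf_emeasure) (auto simp: \<mu>_def disj)
  also have "\<dots> \<le> (\<integral>\<^sup>+y. ennreal (norm (g y)) \<partial>lebesgue)"
    by (subst \<mu>) (auto intro!: nn_integral_mono simp: indicator_def)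
  finally show ?thesis unfolding S_def by (auto simp: mult_left_mono)
qed

text \<open>Only the part of \<open>g\<close> above half the level matters, the rest contributes at most \<open>s\<close> to the
  maximal function.\<close>

lemma maximal_weak_type_truncated:
  fixes g :: "'a::euclidean_space \<Rightarrow> 'b::{real_normed_vector,second_countable_topology}"
  assumes g[measurable]: "g \<in> borel_measurable lebesgue" and s: "0 < s"
  shows "ennreal s * emeasure lebesgue {x. maximal g x > ennreal (2 * s)}
    \<le> ennreal (5 ^ DIM('a)) * (\<integral>\<^sup>+y. ennreal (norm (g y)) * indicator {y. norm (g y) > s} y \<partial>lebesgue)"
proof -
  define h where "h y = indicat_real {y. norm (g y) > s} y *\<^sub>R g y" for y
  have h[measurable]: "h \<in> borel_measurable lebesgue" unfolding h_def by measurable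
  have "maximal h x > ennreal s" if x: "maximal g x > ennreal (2 * s)" for x
  proof -
    define \<omega> where "\<omega> = measure lborel (ball (0::'a) 1)"
    obtain r where r: "0 < r"
      "ennreal (2 * s * (r ^ DIM('a) * \<omega>)) < (\<integral>\<^sup>+y\<in>ball x r. ennreal (norm (g y)) \<partial>lebesgue)"
      using x maximal_gt_iff[of "2 * s" g x] s by (auto simp: \<omega>_def)
    have [measurable]: "ball x r \<in> sets lebesgue" by simp
    have "(\<integral>\<^sup>+y\<in>ball x r. ennreal (norm (g y)) \<partial>lebesgue)
       \<le> (\<integral>\<^sup>+y. ennreal (norm (h y)) * indicator (ball x r) y + ennreal s * indicator (ball x r) y \<partial>lebesgue)"
      by (intro nn_integral_mono) (auto simp: h_def indicator_def not_less intro: ennreal_leI)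
    also have "\<dots> = (\<integral>\<^sup>+y\<in>ball x r. ennreal (norm (h y)) \<partial>lebesgue) + ennreal s * emeasure lebesgue (ball x r)"
      by (subst nn_integral_add; (measurable; fail)?) (auto simp: nn_integral_cmult_indicator)
    also have "ennreal s * emeasure lebesgue (ball x r) = ennreal (s * (r ^ DIM('a) * \<omega>))"
      using s r by (simp add: emeasure_lborel_ball \<omega>_def ennreal_mult)
    finally have le: "(\<integral>\<^sup>+y\<in>ball x r. ennreal (norm (g y)) \<partial>lebesgue)
       \<le> (\<integral>\<^sup>+y\<in>ball x r. ennreal (norm (h y)) \<partial>lebesgue) + ennreal (s * (r ^ DIM('a) * \<omega>))" .
    define a where "a = s * (r ^ DIM('a) * \<omega>)"
    have a: "0 \<le> a" using s r by (simp add: a_def \<omega>_def)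
    have "2 * s * (r ^ DIM('a) * \<omega>) = a + a" by (simp add: a_def)
    then have eq: "ennreal (2 * s * (r ^ DIM('a) * \<omega>)) = ennreal a + ennreal a"
      using a by (metis ennreal_plus)
    have "ennreal a + ennreal a < (\<integral>\<^sup>+y\<in>ball x r. ennreal (norm (h y)) \<partial>lebesgue) + ennreal a"
      using less_le_trans[OF r(2) le] unfolding eq a_def[symmetric] .
    then have "ennreal a < (\<integral>\<^sup>+y\<in>ball x r. ennreal (norm (h y)) \<partial>lebesgue)"
    proof (rule contrapos_pp)
      assume "\<not> ennreal a < (\<integral>\<^sup>+y\<in>ball x r. ennreal (norm (h y)) \<partial>lebesgue)"
      then show "\<not> ennreal a + ennreal a < (\<integral>\<^sup>+y\<in>ball x r. ennreal (norm (h y)) \<partial>lebesgue) + ennreal a"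
        unfolding not_less by (rule add_right_mono)
    qed
    then show ?thesis using maximal_gt_iff[of s h x] s r by (auto simp: a_def \<omega>_def)
  qed
  then have "ennreal s * emeasure lebesgue {x. maximal g x > ennreal (2 * s)}
    \<le> ennreal s * emeasure lebesgue {x. maximal h x > ennreal s}"
    using open_maximal_gt[of s h] s by (intro mult_left_mono emeasure_mono) auto
  also have "\<dots> \<le> ennreal (5 ^ DIM('a)) * (\<integral>\<^sup>+y. ennreal (norm (h y)) \<partial>lebesgue)"
    by (rule maximal_weak_type) (use s in auto)
  also have "(\<lambda>y. ennreal (norm (h y))) = (\<lambda>y. ennreal (norm (g y)) * indicator {y. norm (g y) > s} y)"
    by (auto simp: h_def indicator_def)
  finally show ?thesis .
qed

section \<open>Tails of weakly integrable functions\<close>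

text \<open>Take the least exponent with \<open>x \<le> 2 ^ n * t\<close>; it is positive because
  \<open>t < x\<close>, so it has a predecessor.\<close>

lemma dyadic_level:
  fixes t x :: real
  assumes "0 < t" "t < x"
  shows "\<exists>k::nat. 2 ^ k * t < x \<and> x \<le> 2 ^ Suc k * t"
proof -
  obtain m :: nat where "x / t < 2 ^ m"
    using real_arch_pow[of 2 "x / t"] by auto
  then have ex: "\<exists>m::nat. x \<le> 2 ^ m * t"
    using assms by (auto simp: field_simps intro!: exI[of _ m])
  define n where "n = (LEAST m::nat. x \<le> 2 ^ m * t)"
  have n: "x \<le> 2 ^ n * t" unfolding n_def by (rule LeastI_ex[OF ex])
  have "n \<noteq> 0" using n assms by (metis mult_1 not_le power_0)
  then obtain k where k: "n = Suc k" by (cases n) auto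
  have "\<not> x \<le> 2 ^ k * t"
    using not_less_Least[of k "\<lambda>m. x \<le> 2 ^ m * t"] k unfolding n_def[symmetric] by simp
  then show ?thesis using n k by (intro exI[of _ k]) auto
qed

text \<open>On the layer between \<open>2 ^ k * t\<close> and \<open>2 ^ Suc k * t\<close> the
  integrand is at most \<open>(2 ^ Suc k * t) powr p\<close>, while the measure decays with exponent
  \<open>q\<close>. The resulting series is geometric with ratio \<open>2 powr (p - q)\<close>,
  which is below 1.\<close>

lemma tail_integral_le_weak_bound:
  fixes g :: "'a \<Rightarrow> 'b::{real_normed_vector,second_countable_topology}" and p q K t :: real
  assumes g: "g \<in> borel_measurable M" and pq: "0 < p" "p < q" and "0 \<le> K" and t: "0 < t"
    and weak: "\<And>s. 0 < s \<Longrightarrow> emeasure M {x \<in> space M. norm (g x) > s} \<le> ennreal (K * s powr (-q))"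
  shows "(\<integral>\<^sup>+x. ennreal (norm (g x) powr p) * indicator {x. norm (g x) > t} x \<partial>M)
    \<le> ennreal (2 powr p / (1 - 2 powr (p - q)) * K * t powr (p - q))"
proof -
  \<comment> \<open>Full superlevel sets stand in for the layers: the overcounting is absorbed by
    the geometric decay, and the weak bound applies to them directly.\<close>
  define A where "A k = {x \<in> space M. norm (g x) > 2 ^ k * t}" for k :: nat
  define c where "c k = (2 ^ Suc k * t) powr p" for k :: nat
  have A[measurable]: "A k \<in> sets M" for k
    unfolding A_def using g by measurable
  have "(\<integral>\<^sup>+x. ennreal (norm (g x) powr p) * indicator {x. norm (g x) > t} x \<partial>M)
      \<le> (\<integral>\<^sup>+x. (\<Sum>k. ennreal (c k) * indicator (A k) x) \<partial>M)"
  proof (rule nn_integral_mono)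
    fix x assume x: "x \<in> space M"
    show "ennreal (norm (g x) powr p) * indicator {x. norm (g x) > t} x
      \<le> (\<Sum>k. ennreal (c k) * indicator (A k) x)"
    proof (cases "norm (g x) > t")
      case True
      obtain k :: nat where k: "2 ^ k * t < norm (g x)" "norm (g x) \<le> 2 ^ Suc k * t"
        using dyadic_level[OF t True] by blast
      have "ennreal (norm (g x) powr p) * indicator {x. norm (g x) > t} x \<le> ennreal (c k) * indicator (A k) x"
        using k x pq True by (auto simp: A_def c_def intro!: ennreal_leI powr_mono2)
      also have "\<dots> \<le> (\<Sum>k. ennreal (c k) * indicator (A k) x)"
        using sum_le_suminf[of "\<lambda>k. ennreal (c k) * indicator (A k) x" "{k}", OF summableI]
        by (simp del: sum_mult_indicator)
      finally show ?thesis .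
    qed simp
  qed
  also have "\<dots> = (\<Sum>k. ennreal (c k) * emeasure M (A k))"
    by (subst nn_integral_suminf) (auto simp: nn_integral_cmult_indicator)
  also have "\<dots> \<le> (\<Sum>k. ennreal (2 powr p * K * t powr (p - q) * (2 powr (p - q)) ^ k))"
  proof (intro suminf_le)
    fix k
    have "ennreal (c k) * emeasure M (A k) \<le> ennreal (c k) * ennreal (K * (2 ^ k * t) powr (-q))"
      unfolding A_def using t by (intro mult_left_mono weak) auto
    also have "\<dots> = ennreal (c k * (K * (2 ^ k * t) powr (-q)))"
      by (subst ennreal_mult[symmetric]) (use \<open>0 \<le> K\<close> in \<open>auto simp: c_def\<close>)
    also have "c k * (K * (2 ^ k * t) powr (-q)) = 2 powr p * K * t powr (p - q) * (2 powr (p - q)) ^ k"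
    proof -
      have "c k = 2 powr p * (2 ^ k * t) powr p"
        using t by (simp add: c_def powr_mult mult.assoc)
      moreover have "(2 ^ k * t) powr p * (2 ^ k * t) powr (-q) = (2 powr (p - q)) ^ k * t powr (p - q)"
      proof -
        have "(2 ^ k :: real) powr (p - q) = (2 powr (p - q)) ^ k"
          by (simp add: powr_realpow[symmetric] powr_powr mult.commute)
        then have "(2 ^ k * t) powr (p - q) = (2 powr (p - q)) ^ k * t powr (p - q)"
          using t by (simp add: powr_mult)
        then show ?thesis using powr_add[of "2 ^ k * t" p "- q"] by simp
      qed
      ultimately show ?thesis by (simp add: algebra_simps)
    qed
    finally show "ennreal (c k) * emeasure M (A k)
      \<le> ennreal (2 powr p * K * t powr (p - q) * (2 powr (p - q)) ^ k)" .
  qed auto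
  also have "\<dots> = ennreal (\<Sum>k. 2 powr p * K * t powr (p - q) * (2 powr (p - q)) ^ k)"
  proof (rule suminf_ennreal2)
    have "2 powr (p - q) < (1::real)" using powr_less_mono[of "p - q" 0 2] pq by simp
    then show "summable (\<lambda>k. 2 powr p * K * t powr (p - q) * (2 powr (p - q)) ^ k)"
      by (intro summable_mult summable_geometric) simp
  qed (use \<open>0 \<le> K\<close> in auto)
  also have "(\<Sum>k. 2 powr p * K * t powr (p - q) * (2 powr (p - q)) ^ k)
      = 2 powr p / (1 - 2 powr (p - q)) * K * t powr (p - q)"
  proof -
    have "2 powr (p - q) < (1::real)" using powr_less_mono[of "p - q" 0 2] pq by simp
    then show ?thesis
      by (subst suminf_mult) (auto simp: suminf_geometric)
  qed
  finally show ?thesis .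
qed

section \<open>Comparison of the energies\<close>

lemma ennreal_le_divideI:
  assumes "ennreal a * x \<le> ennreal b" "0 < a" "0 \<le> b"
  shows "x \<le> ennreal (b / a)"
proof (cases x)
  case (real r)
  then have "a * r \<le> b" using assms by (simp add: ennreal_mult[symmetric] ennreal_le_iff)
  then show ?thesis using real assms by (simp add: ennreal_leI field_simps)
next
  case top
  then show ?thesis using assms by (simp add: ennreal_mult_top top_unique)
qed

text \<open>The member of the defining supremum at level \<open>s\<close> is \<open>s\<close> times
  the measure of the superlevel set to the power \<open>1/q\<close>; taking powers with exponent
  \<open>q\<close> gives the decay.\<close>

lemma weak_Lp_superlevel_le:
  fixes g :: "'a::euclidean_space \<Rightarrow> 'b::euclidean_space"
  assumes \<Omega>: "\<Omega> \<in> lmeasurable" and q: "0 < q" and g: "g \<in> weak_Lp_space q \<Omega>" and s: "0 < s"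
  shows "emeasure (lebesgue_on \<Omega>) {x \<in> space (lebesgue_on \<Omega>). norm (g x) > s}
    \<le> ennreal (enn2real (weak_Lp_norm q \<Omega> g) powr q * s powr (- q))"
proof -
  interpret finite_measure "lebesgue_on \<Omega>"
    using \<Omega> by (rule finite_measure_lebesgue_on)
  define A where "A = {x \<in> space (lebesgue_on \<Omega>). norm (g x) > s}"
  define m where "m = measure (lebesgue_on \<Omega>) A"
  define N where "N = enn2real (weak_Lp_norm q \<Omega> g)"
  have [measurable]: "g \<in> borel_measurable (lebesgue_on \<Omega>)" and fin: "weak_Lp_norm q \<Omega> g < \<infinity>"
    using g by (auto simp: weak_Lp_space_def)
  have A: "A \<in> sets (lebesgue_on \<Omega>)" unfolding A_def by measurable
  have "(LINT x|lebesgue_on \<Omega>. norm (s * indicat_real {y. norm (g y) > s} x) powr q)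
      = (LINT x|lebesgue_on \<Omega>. s powr q * indicat_real A x)"
    using s q by (intro Bochner_Integration.integral_cong) (auto simp: A_def indicator_def)
  also have "\<dots> = s powr q * m"
    using A sets.sets_into_space[OF A] by (simp add: m_def Int_absorb2)
  finally have "Lp_norm q \<Omega> (\<lambda>x. s * indicat_real {y. norm (g y) > s} x) = (s powr q * m) powr (1/q)"
    by (simp add: Lp_norm_def)
  moreover have "ennreal (Lp_norm q \<Omega> (\<lambda>x. s * indicat_real {y. norm (g y) > s} x)) \<le> weak_Lp_norm q \<Omega> g"
    unfolding weak_Lp_norm_def using s by (intro SUP_upper) auto
  ultimately have "ennreal ((s powr q * m) powr (1/q)) \<le> ennreal N"
    using fin by (simp add: N_def ennreal_enn2real)
  then have "(s powr q * m) powr (1/q) \<le> N"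
    by (simp add: ennreal_le_iff N_def)
  then have "((s powr q * m) powr (1/q)) powr q \<le> N powr q"
    using q by (intro powr_mono2) auto
  then have "s powr q * m \<le> N powr q"
    using q s by (simp add: powr_powr m_def)
  then have "m \<le> N powr q * s powr (- q)"
    using s by (simp add: powr_minus field_simps)
  then show ?thesis
    unfolding A_def[symmetric] N_def[symmetric] emeasure_eq_measure m_def by (rule ennreal_leI)
qed

text \<open>Both contributions scale like \<open>s powr (p - q)\<close>. In the factor
  \<open>1 + 5 ^ DIM('a) * 2 powr q\<close> the 1 stems from the tail above \<open>s\<close>; the
  other summand stems from the measure of the bad set, which is of order
  \<open>s powr (- q)\<close>.\<close>

lemma integral_bad_set_le:
  fixes \<Omega> :: "'a::euclidean_space set"
  defines "C0 \<equiv> \<lambda>p q. 2 powr p / (1 - 2 powr (p - q))"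
  assumes \<Omega>: "open \<Omega>" "bounded \<Omega>" and p: "1 < p" "p < q" and s: "0 < s"
    and g: "wgrad \<Omega> u \<in> weak_Lp_space q \<Omega>"
  shows "(LINT x|lebesgue_on (bad_set \<Omega> u s). norm (wgrad \<Omega> u x) powr p)
      \<le> C0 p q * (1 + 5 ^ DIM('a) * 2 powr q) * enn2real (weak_Lp_norm q \<Omega> (wgrad \<Omega> u)) powr q * s powr (p - q)"
proof -
  define g where "g = wgrad \<Omega> u"
  \<comment> \<open>Extension by zero, the same function whose maximal function defines
    \<open>bad_set\<close>.\<close>
  define h where "h y = indicat_real \<Omega> y *\<^sub>R g y" for y
  define K where "K = enn2real (weak_Lp_norm q \<Omega> g) powr q"
  define O' where "O' = bad_set \<Omega> u s"
  have sets[measurable]: "\<Omega> \<in> sets lebesgue" using \<Omega> by auto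
  have lm: "\<Omega> \<in> lmeasurable" using \<Omega> by (simp add: bounded_set_imp_lmeasurable)
  have gm[measurable]: "g \<in> borel_measurable (lebesgue_on \<Omega>)"
    using g by (simp add: weak_Lp_space_def g_def)
  have "(\<lambda>y. if y \<in> \<Omega> then g y else 0) \<in> borel_measurable lebesgue"
    by (rule borel_measurable_if_I[OF gm sets])
  also have "(\<lambda>y. if y \<in> \<Omega> then g y else 0) = h" by (auto simp: h_def)
  finally have hm[measurable]: "h \<in> borel_measurable lebesgue" .
  have O'_eq: "O' = \<Omega> \<inter> {x. maximal h x > ennreal s}"
    by (auto simp: O'_def bad_set_def h_def[abs_def] g_def)
  have O'_sets[measurable]: "O' \<in> sets lebesgue"
    unfolding O'_eq using open_maximal_gt[of s h] s by (intro sets.Int sets) auto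
  have C0: "0 \<le> C0 p q" using powr_less_mono[of "p - q" 0 2] p by (simp add: C0_def)
  have K: "0 \<le> K" by (simp add: K_def)
  have tail: "(\<integral>\<^sup>+x. ennreal (norm (h x) powr p) * indicator {x. norm (h x) > t} x \<partial>lebesgue)
      \<le> ennreal (C0 p q * K * t powr (p - q))" if t: "0 < t" for t
  proof -
    have "(\<integral>\<^sup>+x. ennreal (norm (h x) powr p) * indicator {x. norm (h x) > t} x \<partial>lebesgue)
        = (\<integral>\<^sup>+x. ennreal (norm (g x) powr p) * indicator {x. norm (g x) > t} x * indicator \<Omega> x \<partial>lebesgue)"
      using t by (intro nn_integral_cong) (auto simp: h_def indicator_def)
    also have "\<dots> = (\<integral>\<^sup>+x. ennreal (norm (g x) powr p) * indicator {x. norm (g x) > t} x \<partial>lebesgue_on \<Omega>)"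
      by (subst nn_integral_restrict_space) auto
    also have "\<dots> \<le> ennreal (C0 p q * K * t powr (p - q))"
      unfolding C0_def
    proof (rule tail_integral_le_weak_bound[OF gm _ p(2) K t])
      show "emeasure (lebesgue_on \<Omega>) {x \<in> space (lebesgue_on \<Omega>). norm (g x) > s} \<le> ennreal (K * s powr (- q))"
        if "0 < s" for s
        unfolding K_def g_def by (rule weak_Lp_superlevel_le[OF lm _ g that]) (use p in simp)
    qed (use p in simp)
    finally show ?thesis .
  qed
  \<comment> \<open>The truncated weak type estimate concerns the level \<open>2 * t\<close>;
    halving \<open>s\<close> is the source of the factor \<open>2 powr q\<close>.\<close>
  define t where "t = s / 2"
  have t: "0 < t" "2 * t = s" using s by (auto simp: t_def)
  \<comment> \<open>Above the level \<open>t\<close> the first power is at most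
    \<open>t powr (1 - p)\<close> times the \<open>p\<close>-th power, because \<open>1 < p\<close>;
    thus the tail bound also serves the weak type estimate.\<close>
  have "(\<integral>\<^sup>+y. ennreal (norm (h y)) * indicator {y. norm (h y) > t} y \<partial>lebesgue)
      \<le> (\<integral>\<^sup>+x. ennreal (t powr (1 - p)) * (ennreal (norm (h x) powr p) * indicator {x. norm (h x) > t} x) \<partial>lebesgue)"
  proof (rule nn_integral_mono)
    fix x
    show "ennreal (norm (h x)) * indicator {y. norm (h y) > t} x
      \<le> ennreal (t powr (1 - p)) * (ennreal (norm (h x) powr p) * indicator {x. norm (h x) > t} x)"
    proof (cases "norm (h x) > t")
      case True
      have "norm (h x) = norm (h x) powr (1 - p) * norm (h x) powr p"
        using True t by (simp add: powr_add[symmetric])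
      also have "\<dots> \<le> t powr (1 - p) * norm (h x) powr p"
        using True t p by (intro mult_right_mono powr_mono2') auto
      finally show ?thesis using True by (simp add: ennreal_mult[symmetric] ennreal_leI)
    qed simp
  qed
  also have "\<dots> = ennreal (t powr (1 - p)) * (\<integral>\<^sup>+x. ennreal (norm (h x) powr p) * indicator {x. norm (h x) > t} x \<partial>lebesgue)"
    by (rule nn_integral_cmult) measurable
  also have "\<dots> \<le> ennreal (t powr (1 - p)) * ennreal (C0 p q * K * t powr (p - q))"
    by (intro mult_left_mono tail t) auto
  finally have L1: "(\<integral>\<^sup>+y. ennreal (norm (h y)) * indicator {y. norm (h y) > t} y \<partial>lebesgue)
      \<le> ennreal (t powr (1 - p) * (C0 p q * K * t powr (p - q)))"
    using C0 K by (simp add: ennreal_mult)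
  have "ennreal t * emeasure lebesgue O' \<le> ennreal t * emeasure lebesgue {x. maximal h x > ennreal (2 * t)}"
    using open_maximal_gt[of s h] s t by (intro mult_left_mono emeasure_mono) (auto simp: O'_eq)
  also have "\<dots> \<le> ennreal (5 ^ DIM('a)) * (\<integral>\<^sup>+y. ennreal (norm (h y)) * indicator {y. norm (h y) > t} y \<partial>lebesgue)"
    by (rule maximal_weak_type_truncated[OF hm t(1)])
  also have "\<dots> \<le> ennreal (5 ^ DIM('a)) * ennreal (t powr (1 - p) * (C0 p q * K * t powr (p - q)))"
    by (intro mult_left_mono L1) auto
  also have "\<dots> = ennreal (5 ^ DIM('a) * (t powr (1 - p) * (C0 p q * K * t powr (p - q))))"
    using C0 K by (simp add: ennreal_mult)
  finally have "emeasure lebesgue O' \<le> ennreal (5 ^ DIM('a) * (t powr (1 - p) * (C0 p q * K * t powr (p - q))) / t)"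
    by (rule ennreal_le_divideI) (use C0 K t in auto)
  also have "5 ^ DIM('a) * (t powr (1 - p) * (C0 p q * K * t powr (p - q))) / t = 5 ^ DIM('a) * C0 p q * K * t powr (- q)"
  proof -
    have "t powr (1 - p) * t powr (p - q) = t powr (- q) * t"
      using t by (simp add: powr_add[symmetric] powr_diff powr_minus field_simps)
    then show ?thesis using t by (simp add: field_simps)
  qed
  finally have meas: "emeasure lebesgue O' \<le> ennreal (5 ^ DIM('a) * C0 p q * K * t powr (- q))" .
  have "(\<integral>\<^sup>+x. ennreal (norm (g x) powr p) \<partial>lebesgue_on O')
      = (\<integral>\<^sup>+x. ennreal (norm (g x) powr p) * indicator O' x \<partial>lebesgue)"
    by (subst nn_integral_restrict_space) auto
  also have "\<dots> \<le> (\<integral>\<^sup>+x. ennreal (norm (h x) powr p) * indicator {x. norm (h x) > s} x + ennreal (s powr p) * indicator O' x \<partial>lebesgue)"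
    using p by (intro nn_integral_mono)
      (auto simp: O'_eq h_def indicator_def not_less intro!: ennreal_leI powr_mono2)
  also have "\<dots> = (\<integral>\<^sup>+x. ennreal (norm (h x) powr p) * indicator {x. norm (h x) > s} x \<partial>lebesgue) + ennreal (s powr p) * emeasure lebesgue O'"
    by (subst nn_integral_add; (measurable; fail)?) (auto simp: nn_integral_cmult_indicator)
  also have "\<dots> \<le> ennreal (C0 p q * K * s powr (p - q)) + ennreal (s powr p) * ennreal (5 ^ DIM('a) * C0 p q * K * t powr (- q))"
    by (intro add_mono tail s mult_left_mono meas) auto
  also have "\<dots> = ennreal (C0 p q * K * s powr (p - q) + s powr p * (5 ^ DIM('a) * C0 p q * K * t powr (- q)))"
    using C0 K by (simp add: ennreal_mult ennreal_plus)
  also have "C0 p q * K * s powr (p - q) + s powr p * (5 ^ DIM('a) * C0 p q * K * t powr (- q))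
      = C0 p q * (1 + 5 ^ DIM('a) * 2 powr q) * K * s powr (p - q)"
  proof -
    have "t powr (- q) = 2 powr q * s powr (- q)"
      using s by (simp add: t_def powr_divide powr_minus field_simps)
    moreover have "s powr p * s powr (- q) = s powr (p - q)"
      by (simp add: powr_add[symmetric])
    ultimately have "s powr p * t powr (- q) = 2 powr q * s powr (p - q)" by (simp add: ac_simps)
    then have "s powr p * (5 ^ DIM('a) * C0 p q * K * t powr (- q)) = 5 ^ DIM('a) * C0 p q * K * (2 powr q * s powr (p - q))"
      by (metis (no_types, lifting) mult.left_commute)
    then show ?thesis by (simp add: algebra_simps)
  qed
  finally have nn: "(\<integral>\<^sup>+x. ennreal (norm (g x) powr p) \<partial>lebesgue_on O')
      \<le> ennreal (C0 p q * (1 + 5 ^ DIM('a) * 2 powr q) * K * s powr (p - q))" .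
  have "O' \<subseteq> \<Omega>" by (auto simp: O'_eq)
  have gO[measurable]: "g \<in> borel_measurable (lebesgue_on O')"
    by (rule measurable_restrict_mono[OF gm \<open>O' \<subseteq> \<Omega>\<close>])
  have "(LINT x|lebesgue_on O'. norm (g x) powr p) = enn2real (\<integral>\<^sup>+x. ennreal (norm (g x) powr p) \<partial>lebesgue_on O')"
    by (rule integral_eq_nn_integral) auto
  also have "\<dots> \<le> C0 p q * (1 + 5 ^ DIM('a) * 2 powr q) * K * s powr (p - q)"
    by (rule enn2real_leI[OF _ nn]) (use C0 K in auto)
  finally show "(LINT x|lebesgue_on (bad_set \<Omega> u s). norm (wgrad \<Omega> u x) powr p)
      \<le> C0 p q * (1 + 5 ^ DIM('a) * 2 powr q) * enn2real (weak_Lp_norm q \<Omega> (wgrad \<Omega> u)) powr q * s powr (p - q)"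
    by (simp add: O'_def g_def K_def)
qed

text \<open>Membership in \<open>sobolev0 2\<close> puts \<open>w\<close> into the finite branch of
  the relaxed energy, membership in \<open>sobolev0 p\<close> makes the comparison integrand
  integrable. The additive constant from \<open>kappa_bounds\<close> is integrated over a set of
  finite measure.\<close>

lemma relaxed_energy_le:
  assumes \<Omega>: "\<Omega> \<in> lmeasurable" and p: "0 < p" "p < 2" and \<epsilon>: "0 < \<epsilon>m"
    and w: "w \<in> sobolev0 2 \<Omega>" "w \<in> sobolev0 p \<Omega>"
    and grad: "AE x in lebesgue_on \<Omega>. norm (wgrad \<Omega> w x) \<le> \<epsilon>p"
  shows "relaxed_energy p \<Omega> f \<epsilon>m \<epsilon>p w \<le> ereal (energy p \<Omega> f w + measure lebesgue \<Omega> * \<epsilon>m powr p / p)"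
proof -
  interpret finite_measure "lebesgue_on \<Omega>"
    using \<Omega> by (rule finite_measure_lebesgue_on)
  have int: "integrable (lebesgue_on \<Omega>) (\<lambda>x. norm (wgrad \<Omega> w x) powr p)"
    using w(2) sobolevD(3)[of w p \<Omega>] by (auto simp: sobolev0_def Lp_space_def)
  have "(LINT x|lebesgue_on \<Omega>. kappa p \<epsilon>m \<epsilon>p (norm (wgrad \<Omega> w x)))
      \<le> (LINT x|lebesgue_on \<Omega>. norm (wgrad \<Omega> w x) powr p / p + \<epsilon>m powr p / p)"
  \<comment> \<open>Only the dominating side has to be integrable and nonnegative: a non-integrable
    left integrand would have integral 0 by convention.\<close>
  proof (rule integral_mono_AE')
    show "AE x in lebesgue_on \<Omega>. kappa p \<epsilon>m \<epsilon>p (norm (wgrad \<Omega> w x))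
        \<le> norm (wgrad \<Omega> w x) powr p / p + \<epsilon>m powr p / p"
      using grad by eventually_elim (use p \<epsilon> kappa_bounds(2) in auto)
  qed (use int p in auto)
  also have "\<dots> = 1 / p * (LINT x|lebesgue_on \<Omega>. norm (wgrad \<Omega> w x) powr p) + measure lebesgue \<Omega> * \<epsilon>m powr p / p"
    using int \<Omega> by (simp add: measure_restrict_space)
  finally show ?thesis using w by (simp add: relaxed_energy_def energy_def)
qed

theorem lemma12:
  fixes \<Omega> :: "'a::euclidean_space set" and p q :: real
  assumes "open \<Omega>" and "bounded \<Omega>"
    and "1 < p" and "p < 2" and "p < q"
    and "admits_lipschitz_truncation p \<Omega>"
  shows "\<exists>C>0. \<forall>f\<in>sobolev0_dual p \<Omega>. \<forall>u.
           is_minimizer p \<Omega> (energy p \<Omega> f) u \<and> wgrad \<Omega> u \<in> weak_Lp_space q \<Omega> \<longrightarrow>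
           (\<forall>\<epsilon>m \<epsilon>p u\<epsilon>. 0 < \<epsilon>m \<and> \<epsilon>m \<le> \<epsilon>p \<and>
              is_minimizer p \<Omega> (relaxed_energy p \<Omega> f \<epsilon>m \<epsilon>p) u\<epsilon> \<longrightarrow>
              relaxed_energy p \<Omega> f \<epsilon>m \<epsilon>p u\<epsilon> - ereal (energy p \<Omega> f u) \<le>
              ereal (C * (\<epsilon>m powr p
                + \<epsilon>p powr (- (q - p)) * enn2real (weak_Lp_norm q \<Omega> (wgrad \<Omega> u)) powr q)))"
proof -
  \<comment> \<open>\<open>c\<close> is fixed before \<open>f\<close>, \<open>u\<close> and the
    relaxation interval, so the constants built from it depend on \<open>p\<close>, \<open>q\<close>
    and \<open>\<Omega>\<close> (with its dimension) only.\<close>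
  obtain c where c: "0 < c"
    and trunc: "\<And>v. v \<in> sobolev0 p \<Omega> \<Longrightarrow> \<exists>T::real \<Rightarrow> 'a \<Rightarrow> real. \<forall>s>0. is_truncation p \<Omega> c v s (T s)"
    using assms(6) unfolding admits_lipschitz_truncation_def by blast
  have lm: "\<Omega> \<in> lmeasurable" using assms by (simp add: bounded_set_imp_lmeasurable)
  define A where "A = 2 powr p / (1 - 2 powr (p - q)) * (1 + 5 ^ DIM('a) * 2 powr q)"
  have A: "0 \<le> A" using powr_less_mono[of "p - q" 0 2] assms by (simp add: A_def)
  \<comment> \<open>Here \<open>2 / p\<close> is the factor in \<open>energy_gap_le\<close>,
    \<open>c powr p\<close> comes from the truncation error, \<open>A\<close> from the bad set
    estimate, and \<open>c powr (q - p)\<close> from rewriting \<open>s powr (p - q)\<close> with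
    \<open>s = \<epsilon>p / c\<close>.\<close>
  define B where "B = 2 / p * (c powr p * A * c powr (q - p))"
  have B: "0 \<le> B" using A assms by (simp add: B_def)
  \<comment> \<open>The first two summands dominate the two error coefficients; the 1 makes
    positivity immediate.\<close>
  define C where "C = measure lebesgue \<Omega> / p + B + 1"
  have C: "measure lebesgue \<Omega> / p \<le> C" "B \<le> C" "0 < C"
    using B assms by (auto simp: C_def add_nonneg_pos)
  have "relaxed_energy p \<Omega> f \<epsilon>m \<epsilon>p u\<epsilon> - ereal (energy p \<Omega> f u)
      \<le> ereal (C * (\<epsilon>m powr p + \<epsilon>p powr (- (q - p)) * enn2real (weak_Lp_norm q \<Omega> (wgrad \<Omega> u)) powr q))"
    if f: "f \<in> sobolev0_dual p \<Omega>" and u: "is_minimizer p \<Omega> (energy p \<Omega> f) u"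
      and gu: "wgrad \<Omega> u \<in> weak_Lp_space q \<Omega>" and \<epsilon>: "0 < \<epsilon>m" "\<epsilon>m \<le> \<epsilon>p"
      and u\<epsilon>: "is_minimizer p \<Omega> (relaxed_energy p \<Omega> f \<epsilon>m \<epsilon>p) u\<epsilon>"
    for f u \<epsilon>m \<epsilon>p u\<epsilon>
  proof -
    define K where "K = enn2real (weak_Lp_norm q \<Omega> (wgrad \<Omega> u)) powr q"
    define s where "s = \<epsilon>p / c"
    have s: "0 < s" "c * s = \<epsilon>p" using \<epsilon> c by (auto simp: s_def)
    have u0: "u \<in> sobolev0 p \<Omega>" using u by (simp add: is_minimizer_def is_arg_min_def)
    obtain w where w: "is_truncation p \<Omega> c u s w" using trunc[OF u0] s by blast
    have w0: "w \<in> sobolev0 p \<Omega>" "w \<in> sobolev0 2 \<Omega>"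
      using w assms by (auto simp: is_truncation_def sobolev0_inf_def)
    have grad: "AE x in lebesgue_on \<Omega>. norm (wgrad \<Omega> w x) \<le> \<epsilon>p"
      using w s by (simp add: is_truncation_def)
    have diff: "Lp_norm p \<Omega> (wgrad \<Omega> (\<lambda>x. u x - w x)) \<le> c * Lp_norm p (bad_set \<Omega> u s) (wgrad \<Omega> u)"
      using w by (simp add: is_truncation_def)
    have "(LINT x|lebesgue_on \<Omega>. norm (wgrad \<Omega> (\<lambda>x. u x - w x) x) powr p)
        = Lp_norm p \<Omega> (wgrad \<Omega> (\<lambda>x. u x - w x)) powr p"
      using assms by (simp add: Lp_norm_powr)
    also have "\<dots> \<le> (c * Lp_norm p (bad_set \<Omega> u s) (wgrad \<Omega> u)) powr p"
      using diff assms by (intro powr_mono2) (auto simp: Lp_norm_def)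
    also have "\<dots> = c powr p * (LINT x|lebesgue_on (bad_set \<Omega> u s). norm (wgrad \<Omega> u x) powr p)"
      using c assms by (simp add: powr_mult Lp_norm_powr Lp_norm_def powr_powr)
    also have "\<dots> \<le> c powr p * (A * K * s powr (p - q))"
      using integral_bad_set_le[OF assms(1,2,3,5) s(1) gu] unfolding A_def K_def
      by (intro mult_left_mono) auto
    also have "s powr (p - q) = \<epsilon>p powr (- (q - p)) * c powr (q - p)"
      using c \<epsilon> powr_minus[of c "p - q"] by (simp add: s_def powr_divide field_simps)
    finally have I: "(LINT x|lebesgue_on \<Omega>. norm (wgrad \<Omega> (\<lambda>x. u x - w x) x) powr p)
        \<le> c powr p * (A * K * (\<epsilon>p powr (- (q - p)) * c powr (q - p)))" .
    have "energy p \<Omega> f w - energy p \<Omega> f u \<le> 2 / p * (LINT x|lebesgue_on \<Omega>. norm (wgrad \<Omega> (\<lambda>x. u x - w x) x) powr p)"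
      by (rule energy_gap_le[OF assms(1,3) _ f u w0(1)]) (use assms in simp)
    also have "\<dots> \<le> 2 / p * (c powr p * (A * K * (\<epsilon>p powr (- (q - p)) * c powr (q - p))))"
      using I assms by (intro mult_left_mono) auto
    also have "\<dots> = B * (\<epsilon>p powr (- (q - p)) * K)" by (simp add: B_def mult_ac)
    finally have gap: "energy p \<Omega> f w - energy p \<Omega> f u \<le> B * (\<epsilon>p powr (- (q - p)) * K)" .
    have "relaxed_energy p \<Omega> f \<epsilon>m \<epsilon>p u\<epsilon> \<le> relaxed_energy p \<Omega> f \<epsilon>m \<epsilon>p w"
      using u\<epsilon> w0 by (auto simp: is_minimizer_def is_arg_min_def not_less)
    also have "\<dots> \<le> ereal (energy p \<Omega> f w + measure lebesgue \<Omega> * \<epsilon>m powr p / p)"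
      by (rule relaxed_energy_le) (use assms lm \<epsilon> w0 grad in auto)
    finally have "relaxed_energy p \<Omega> f \<epsilon>m \<epsilon>p u\<epsilon> - ereal (energy p \<Omega> f u)
        \<le> ereal (energy p \<Omega> f w + measure lebesgue \<Omega> * \<epsilon>m powr p / p) - ereal (energy p \<Omega> f u)"
      by (rule ereal_minus_mono) simp
    also have "\<dots> = ereal (measure lebesgue \<Omega> / p * \<epsilon>m powr p + (energy p \<Omega> f w - energy p \<Omega> f u))"
      by simp
    also have "measure lebesgue \<Omega> / p * \<epsilon>m powr p + (energy p \<Omega> f w - energy p \<Omega> f u)
        \<le> C * \<epsilon>m powr p + C * (\<epsilon>p powr (- (q - p)) * K)"
      using gap C by (intro add_mono order_trans[OF gap] mult_right_mono) (auto simp: K_def)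
    finally show ?thesis by (simp add: K_def distrib_left)
  qed
  then show ?thesis using C(3) by blast
qed

end
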